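(* Let $F$ be a fullerene with $n\equiv 2\pmod 6$ vertices and $c(F)=\lfloor n/6\rfloor-3$, and let $(\mathcal{H},M)$ be a Clar structure of $F$. Then $\mathcal{L}^{-1}(\mathscr{E}(\mathcal{H},M))$ is a plane graph with $(n+16)/3$ vertices whose faces are exactly $10$ quadrilaterals and otherwise hexagons, and which belongs to one of the following three classes: (1) it has exactly two vertices of degree $5$ and all other vertices of degree $3$, each vertex of degree $5$ is incident with at least $4$ quadrilaterals, and each partite set contains exactly one vertex of degree $5$; (2) it has exactly two vertices of degree $4$, one vertex of degree $5$, and all other vertices of degree $3$, the vertex of degree $5$ is incident with at least $4$ quadrilaterals, each vertex of degree $4$ is incident with at least $2$ quadrilaterals, and one partite set contains both vertices of degree $4$ while the other partite set contains the vertex of degree $5$; (3) it has exactly four vertices of degree $4$ and all other vertices of degree $3$, each vertex of degree $4$ is incident with at least $2$ quadrilaterals, and each partite set contains exactly two vertices of degree $4$.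
   Context: A fullerene is a finite, trivalent plane graph all of whose faces are pentagons and hexagons. For a perfect matching, a face is alternating if exactly half of its boundary edges lie in it. A resonant pattern is a set of pairwise vertex-disjoint faces all alternating with respect to one common perfect matching; $c(F)$ is the maximum size of a resonant pattern, and a Clar set is one of size $c(F)$. A Clar structure is a pair $(\mathcal{H},M)$ with $\mathcal{H}$ a Clar set and $M$ a perfect matching of $F$ minus the vertices of the faces in $\mathcal{H}$. The expansion $\mathscr{E}(\mathcal{H},M)$ is obtained from $F$ by widening each edge $uv\in M$ into a quadrilateral face (each of $u,v$ is split into an edge, with two new edges joining the split pairs, the other edges at $u,v$ distributed consistently with the embedding); let $\mathcal{Q}$ be the set of these new quadrilaterals. The parent $\mathcal{L}^{-1}(\mathscr{E}(\mathcal{H},M))$ is the plane graph with one vertex inside each face of $\mathscr{E}(\mathcal{H},M)$ not in $\mathcal{H}\cup\mathcal{Q}$, two vertices joined when the corresponding faces share an edge. It is a connected plane graph all of whose faces have even length, hence bipartite with a unique bipartition into two partite sets. *)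

theory Defs
  imports Complex_Main "Graph_Theory.Graph_Theory" "HOL-Combinatorics.Orbits"
begin

section \<open>Plane graphs\<close>

text \<open>
  An embedding into an oriented closed surface is given by its rotation system: every undirected
  edge is a pair of mutually opposite arcs, and \<open>rot\<close> maps an arc to the next arc, in
  counterclockwise order, with the same tail.
\<close>

record ('v, 'a) embedded_graph =
  skel :: "('v, 'a) pre_digraph"
  opp :: "'a \<Rightarrow> 'a"
  rot :: "'a \<Rightarrow> 'a"

text \<open>
  \<open>face_succ\<close> walks along the boundary of the face to the left of an arc: at the head of \<open>a\<close> turn
  into the arc preceding the reversal of \<open>a\<close>. A face is represented by the set of the arcs that
  have it on their left.
\<close>

definition face_succ :: "('v, 'a) embedded_graph \<Rightarrow> 'a \<Rightarrow> 'a" where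
  "face_succ X a = inv (rot X) (opp X a)"

definition face_at :: "('v, 'a) embedded_graph \<Rightarrow> 'a \<Rightarrow> 'a set" where
  "face_at X a = orbit (face_succ X) a"

definition faces :: "('v, 'a) embedded_graph \<Rightarrow> 'a set set" where
  "faces X = face_at X ` arcs (skel X)"

definition edge_of :: "('v, 'a) embedded_graph \<Rightarrow> 'a \<Rightarrow> 'v set" where
  "edge_of X a = {tail (skel X) a, head (skel X) a}"

definition edges :: "('v, 'a) embedded_graph \<Rightarrow> 'v set set" where
  "edges X = edge_of X ` arcs (skel X)"

definition face_verts :: "('v, 'a) embedded_graph \<Rightarrow> 'a set \<Rightarrow> 'v set" where
  "face_verts X f = tail (skel X) ` f"

definition face_edges :: "('v, 'a) embedded_graph \<Rightarrow> 'a set \<Rightarrow> 'v set set" where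
  "face_edges X f = edge_of X ` f"

text \<open>
  The locale \<open>graph\<close> makes the underlying graph finite and simple. For a connected rotation system
  with at least one edge, Euler's formula says that the surface is the sphere.
\<close>

locale connected_plane_graph =
  fixes X :: "('v, 'a) embedded_graph"
  assumes simple_graph: "graph (skel X)"
    and conn: "Digraph_Component.connected (skel X)"
    and opposite: "bidirected_digraph (skel X) (opp X)"
    and rot_permutes: "rot X permutes arcs (skel X)"
    and rot_cyclic: "\<And>v. v \<in> verts (skel X) \<Longrightarrow> out_arcs (skel X) v \<noteq> {} \<Longrightarrow>
          cyclic_on (rot X) (out_arcs (skel X) v)"
    and euler: "int (card (verts (skel X))) - int (card (edges X)) + int (card (faces X)) = 2"

definition degree :: "('v, 'a) embedded_graph \<Rightarrow> 'v \<Rightarrow> nat" where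
  "degree X v = out_degree (skel X) v"

text \<open>A face that is a \<open>k\<close>-gon is bounded by a cycle of length \<open>k\<close>, not just by a closed walk.\<close>

definition polygon :: "('v, 'a) embedded_graph \<Rightarrow> nat \<Rightarrow> 'a set \<Rightarrow> bool" where
  "polygon X k f \<longleftrightarrow> f \<in> faces X \<and> card f = k \<and> card (face_verts X f) = k"

definition quads_at :: "('v, 'a) embedded_graph \<Rightarrow> 'v \<Rightarrow> 'a set set" where
  "quads_at X v = {f. polygon X 4 f \<and> v \<in> face_verts X f}"

definition bipartition :: "('v, 'a) embedded_graph \<Rightarrow> 'v set \<Rightarrow> 'v set \<Rightarrow> bool" where
  "bipartition X A B \<longleftrightarrow> A \<union> B = verts (skel X) \<and> A \<inter> B = {} \<and>
     (\<forall>e\<in>edges X. \<exists>u\<in>A. \<exists>v\<in>B. e = {u, v})"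


section \<open>Fullerenes and Clar structures\<close>

definition fullerene :: "('v, 'a) embedded_graph \<Rightarrow> bool" where
  "fullerene F \<longleftrightarrow> connected_plane_graph F \<and> (\<forall>v\<in>verts (skel F). degree F v = 3) \<and>
     (\<forall>f\<in>faces F. polygon F 5 f \<or> polygon F 6 f)"

text \<open>\<open>perfect_matching_on X W M\<close>: \<open>M\<close> is a perfect matching of the subgraph of \<open>X\<close> induced by \<open>W\<close>.\<close>

definition perfect_matching_on :: "('v, 'a) embedded_graph \<Rightarrow> 'v set \<Rightarrow> 'v set set \<Rightarrow> bool" where
  "perfect_matching_on X W M \<longleftrightarrow> M \<subseteq> edges X \<and> (\<forall>e\<in>M. e \<subseteq> W) \<and> (\<forall>v\<in>W. \<exists>!e. e \<in> M \<and> v \<in> e)"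

definition alternating :: "('v, 'a) embedded_graph \<Rightarrow> 'v set set \<Rightarrow> 'a set \<Rightarrow> bool" where
  "alternating X N f \<longleftrightarrow> 2 * card (face_edges X f \<inter> N) = card (face_edges X f)"

definition resonant_pattern :: "('v, 'a) embedded_graph \<Rightarrow> 'a set set \<Rightarrow> bool" where
  "resonant_pattern X H \<longleftrightarrow> H \<subseteq> faces X \<and>
     (\<forall>f\<in>H. \<forall>g\<in>H. f \<noteq> g \<longrightarrow> face_verts X f \<inter> face_verts X g = {}) \<and>
     (\<exists>N. perfect_matching_on X (verts (skel X)) N \<and> (\<forall>f\<in>H. alternating X N f))"

definition clar_number :: "('v, 'a) embedded_graph \<Rightarrow> nat" where
  "clar_number X = Max (card ` {H. resonant_pattern X H})"

definition clar_set :: "('v, 'a) embedded_graph \<Rightarrow> 'a set set \<Rightarrow> bool" where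
  "clar_set X H \<longleftrightarrow> resonant_pattern X H \<and> card H = clar_number X"

definition clar_structure ::
    "('v, 'a) embedded_graph \<Rightarrow> 'a set set \<Rightarrow> 'v set set \<Rightarrow> bool" where
  "clar_structure X H M \<longleftrightarrow> clar_set X H \<and>
     perfect_matching_on X (verts (skel X) - \<Union> (face_verts X ` H)) M"


section \<open>Expansion\<close>

text \<open>
  Let \<open>d\<close> be an arc from \<open>u\<close> to \<open>v\<close> whose edge lies in \<open>M\<close>, in a trivalent graph. Looking from
  \<open>u\<close> towards \<open>v\<close>, the vertex \<open>u\<close> is split into \<open>LeftEnd d\<close>, which keeps the arc \<open>rot X d\<close>, and
  \<open>RightEnd d\<close>, which keeps the arc preceding \<open>d\<close>. The arcs \<open>d\<close> and \<open>opp X d\<close> disappear. The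
  halves \<open>LeftEnd d\<close> and \<open>RightEnd (opp X d)\<close> lie on the same side of the edge \<open>uv\<close>, so the
  corners of the new quadrilateral are, in counterclockwise order,
    \<open>LeftEnd d\<close>, \<open>RightEnd d\<close>, \<open>LeftEnd (opp X d)\<close>, \<open>RightEnd (opp X d)\<close>,
  and it lies to the left of \<open>Across d\<close>.
  The new arcs are
    \<open>Across d\<close> from \<open>LeftEnd d\<close> to \<open>RightEnd d\<close>, with opposite \<open>AcrossRev d\<close>, and
    \<open>LeftSide d\<close> from \<open>LeftEnd d\<close> to \<open>RightEnd (opp X d)\<close>, with opposite \<open>RightSide (opp X d)\<close>.
\<close>

datatype ('v, 'a) exp_vertex = Whole 'v | LeftEnd 'a | RightEnd 'a

datatype 'a exp_arc = Old 'a | Across 'a | AcrossRev 'a | LeftSide 'a | RightSide 'a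

definition arcs_of :: "('v, 'a) embedded_graph \<Rightarrow> 'v set set \<Rightarrow> 'a set" where
  "arcs_of X M = {a \<in> arcs (skel X). edge_of X a \<in> M}"

definition exp_verts :: "('v, 'a) embedded_graph \<Rightarrow> 'v set set \<Rightarrow> ('v, 'a) exp_vertex set" where
  "exp_verts X M = Whole ` (verts (skel X) - \<Union> M) \<union> LeftEnd ` arcs_of X M \<union> RightEnd ` arcs_of X M"

definition exp_arcs :: "('v, 'a) embedded_graph \<Rightarrow> 'v set set \<Rightarrow> 'a exp_arc set" where
  "exp_arcs X M = Old ` (arcs (skel X) - arcs_of X M) \<union> Across ` arcs_of X M \<union>
     AcrossRev ` arcs_of X M \<union> LeftSide ` arcs_of X M \<union> RightSide ` arcs_of X M"

fun exp_tail ::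
    "('v, 'a) embedded_graph \<Rightarrow> 'v set set \<Rightarrow> 'a exp_arc \<Rightarrow> ('v, 'a) exp_vertex" where
  "exp_tail X M (Old a) =
     (if inv (rot X) a \<in> arcs_of X M then LeftEnd (inv (rot X) a)
      else if rot X a \<in> arcs_of X M then RightEnd (rot X a)
      else Whole (tail (skel X) a))"
| "exp_tail X M (Across d) = LeftEnd d"
| "exp_tail X M (AcrossRev d) = RightEnd d"
| "exp_tail X M (LeftSide d) = LeftEnd d"
| "exp_tail X M (RightSide d) = RightEnd d"

fun exp_opp :: "('v, 'a) embedded_graph \<Rightarrow> 'a exp_arc \<Rightarrow> 'a exp_arc" where
  "exp_opp X (Old a) = Old (opp X a)"
| "exp_opp X (Across d) = AcrossRev d"
| "exp_opp X (AcrossRev d) = Across d"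
| "exp_opp X (LeftSide d) = RightSide (opp X d)"
| "exp_opp X (RightSide d) = LeftSide (opp X d)"

text \<open>
  Counterclockwise, the arcs at \<open>LeftEnd d\<close> are \<open>LeftSide d\<close>, \<open>Old (rot X d)\<close>, \<open>Across d\<close>, and
  those at \<open>RightEnd d\<close> are \<open>RightSide d\<close>, \<open>AcrossRev d\<close>, \<open>Old (inv (rot X) d)\<close>.
\<close>

fun exp_rot :: "('v, 'a) embedded_graph \<Rightarrow> 'v set set \<Rightarrow> 'a exp_arc \<Rightarrow> 'a exp_arc" where
  "exp_rot X M (Old a) =
     (if inv (rot X) a \<in> arcs_of X M then Across (inv (rot X) a)
      else if rot X a \<in> arcs_of X M then RightSide (rot X a)
      else Old (rot X a))"
| "exp_rot X M (Across d) = LeftSide d"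
| "exp_rot X M (LeftSide d) = Old (rot X d)"
| "exp_rot X M (RightSide d) = AcrossRev d"
| "exp_rot X M (AcrossRev d) = Old (inv (rot X) d)"

definition expansion :: "('v, 'a) embedded_graph \<Rightarrow> 'v set set \<Rightarrow>
    (('v, 'a) exp_vertex, 'a exp_arc) embedded_graph" where
  "expansion X M =
     \<lparr>skel = \<lparr>verts = exp_verts X M, arcs = exp_arcs X M,
              tail = exp_tail X M, head = (\<lambda>a. exp_tail X M (exp_opp X a))\<rparr>,
      opp = (\<lambda>a. if a \<in> exp_arcs X M then exp_opp X a else a),
      rot = (\<lambda>a. if a \<in> exp_arcs X M then exp_rot X M a else a)\<rparr>"

text \<open>
  No vertex of a face in \<open>H\<close> is split, so in the expansion this face has the same boundary as before.
\<close>

definition kept_faces :: "'a set set \<Rightarrow> 'a exp_arc set set" where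
  "kept_faces H = image Old ` H"

definition new_quads ::
    "('v, 'a) embedded_graph \<Rightarrow> 'v set set \<Rightarrow> 'a exp_arc set set" where
  "new_quads X M = (\<lambda>d. face_at (expansion X M) (Across d)) ` arcs_of X M"


section \<open>Parent\<close>

text \<open>
  One vertex in each face outside \<open>S\<close>, and for each edge between two faces outside \<open>S\<close> an edge
  crossing it. The arc \<open>a\<close> itself represents the dual arc that crosses \<open>a\<close> from left to right. The
  counterclockwise order around the new vertex is the order in which the crossed arcs occur along
  the boundary of its face, so \<open>rot\<close> is the first return of \<open>face_succ\<close> to the crossed arcs.
\<close>

definition dual_arcs :: "('v, 'a) embedded_graph \<Rightarrow> 'a set set \<Rightarrow> 'a set" where
  "dual_arcs X S = {a \<in> arcs (skel X). face_at X a \<notin> S \<and> face_at X (opp X a) \<notin> S}"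

definition first_return :: "('a \<Rightarrow> 'a) \<Rightarrow> 'a set \<Rightarrow> 'a \<Rightarrow> 'a" where
  "first_return g K a = (g ^^ (LEAST k. 0 < k \<and> (g ^^ k) a \<in> K)) a"

definition parent ::
    "('v, 'a) embedded_graph \<Rightarrow> 'a set set \<Rightarrow> ('a set, 'a) embedded_graph" where
  "parent X S =
     \<lparr>skel = \<lparr>verts = faces X - S, arcs = dual_arcs X S,
              tail = face_at X, head = (\<lambda>a. face_at X (opp X a))\<rparr>,
      opp = (\<lambda>a. if a \<in> dual_arcs X S then opp X a else a),
      rot = (\<lambda>a. if a \<in> dual_arcs X S
                 then first_return (face_succ X) (dual_arcs X S) a else a)\<rparr>"

definition parent_of_expansion :: "('v, 'a) embedded_graph \<Rightarrow> 'a set set \<Rightarrow> 'v set set \<Rightarrow>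
    ('a exp_arc set, 'a exp_arc) embedded_graph" where
  "parent_of_expansion X H M = parent (expansion X M) (kept_faces H \<union> new_quads X M)"


section \<open>The three classes\<close>

definition verts_of_degree :: "('v, 'a) embedded_graph \<Rightarrow> nat \<Rightarrow> 'v set" where
  "verts_of_degree X k = {v \<in> verts (skel X). degree X v = k}"

text \<open>
  A connected bipartite graph has only one bipartition, so in the following definitions \<open>A\<close> and
  \<open>B\<close> are, for a connected graph, the two partite sets in some order.
\<close>

definition class_5_5 :: "('v, 'a) embedded_graph \<Rightarrow> bool" where
  "class_5_5 P \<longleftrightarrow>
     card (verts_of_degree P 5) = 2 \<and>
     (\<forall>v\<in>verts (skel P) - verts_of_degree P 5. degree P v = 3) \<and>
     (\<forall>v\<in>verts_of_degree P 5. card (quads_at P v) \<ge> 4) \<and>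
     (\<exists>A B. bipartition P A B \<and>
        card (A \<inter> verts_of_degree P 5) = 1 \<and> card (B \<inter> verts_of_degree P 5) = 1)"

definition class_5_4_4 :: "('v, 'a) embedded_graph \<Rightarrow> bool" where
  "class_5_4_4 P \<longleftrightarrow>
     card (verts_of_degree P 4) = 2 \<and> card (verts_of_degree P 5) = 1 \<and>
     (\<forall>v\<in>verts (skel P) - verts_of_degree P 4 - verts_of_degree P 5. degree P v = 3) \<and>
     (\<forall>v\<in>verts_of_degree P 5. card (quads_at P v) \<ge> 4) \<and>
     (\<forall>v\<in>verts_of_degree P 4. card (quads_at P v) \<ge> 2) \<and>
     (\<exists>A B. bipartition P A B \<and> verts_of_degree P 4 \<subseteq> A \<and> verts_of_degree P 5 \<subseteq> B)"

definition class_4_4_4_4 :: "('v, 'a) embedded_graph \<Rightarrow> bool" where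
  "class_4_4_4_4 P \<longleftrightarrow>
     card (verts_of_degree P 4) = 4 \<and>
     (\<forall>v\<in>verts (skel P) - verts_of_degree P 4. degree P v = 3) \<and>
     (\<forall>v\<in>verts_of_degree P 4. card (quads_at P v) \<ge> 2) \<and>
     (\<exists>A B. bipartition P A B \<and>
        card (A \<inter> verts_of_degree P 4) = 2 \<and> card (B \<inter> verts_of_degree P 4) = 2)"

end

theory Submission
  imports Defs
begin

text \<open>
  The heart of the matter is that two faces of a fullerene share at most one edge. If \<open>f\<close> and \<open>g\<close>
  shared two edges, the closed curve through both faces and both edges would separate two regions,
  one of which has at most 4 edges on the boundaries of \<open>f\<close> and \<open>g\<close>. Then there are parallel edges,
  or an edge with the same face on both sides, or the region has exactly 4 such edges and the next
  faces inside are two hexagons that again share two edges, with 4 edges on the inner side. This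
  step is injective on a finite set, so it is a permutation, the rings close up, and all faces are
  hexagons, against Euler's formula.

  In the expansion every vertex lies on exactly one face of \<open>\<H> \<union> \<Q>\<close>. Hence the arcs of the parent
  alternate along the remaining faces, and the faces of the parent are copies of those of
  \<open>\<H> \<union> \<Q>\<close>; they are simple cycles because faces of the fullerene share at most one edge.
  A vertex of degree \<open>d\<close> of the parent comes from a face of length at most 6 that meets
  \<open>2 d - 6\<close> or more ends of edges of \<open>M\<close>, each of which yields a quadrilateral.

  Since all its faces are even, the parent is bipartite. Both partite sets have the degree sum
  \<open>n / 2 + 10\<close>, which modulo 3 leaves \<open>2\<close>, while the total excess of the degrees over \<open>3\<close> is \<open>4\<close>.
  So the excess in each partite set is 2, and the three classes are the ways to distribute it.
\<close>

section \<open>Rotation systems\<close>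

text \<open>An embedding is given by two permutations of the arcs and an Euler count, so no curve or
  region can be named. A region cut off by two edges is encoded by the equations
  \<open>(g ^^ k) a = b\<close> and \<open>(g ^^ m) (o' b) = o' a\<close>, and looking inside it
  means computing with words in \<open>rot\<close> and \<open>opp\<close>. For
  \<open>k + m = 6\<close> these equations give no local contradiction; this is why finiteness and
  Euler's formula have to enter there. For the same reason bipartiteness takes work: that even faces
  suffice is a property of the sphere, and it is obtained by a dimension count modulo 2. The
  constants come from |H| = (n - 20)/6. This leaves 20 vertices outside the faces of
  \<open>H\<close>, so \<open>M\<close> has 10 edges. The parent then has (6|H| + 4 * 10)/2 = n/2 +
  10 edges. The fullerene has n/2 + 2 faces, so the parent has n/2 + 2 - |H| = (n + 16)/3 vertices,
  and the degree sum exceeds three times this number by n + 20 - (n + 16) = 4.\<close>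

lemma orbit_funpow:
  assumes "permutation g"
  shows "(g ^^ card (orbit g a)) a = a"
    and "0 < k \<Longrightarrow> k < card (orbit g a) \<Longrightarrow> (g ^^ k) a \<noteq> a"
    and "b \<in> orbit g a \<Longrightarrow> \<exists>k < card (orbit g a). (g ^^ k) a = b"
proof -
  have self: "a \<in> orbit g a" by (rule permutation_self_in_orbit[OF assms])
  define m where "m = funpow_dist1 g a a"
  have m: "0 < m" "(g ^^ m) a = a"
    using funpow_dist1_prop[OF self] by (auto simp: m_def)
  have least: "\<And>k. 0 < k \<Longrightarrow> k < m \<Longrightarrow> (g ^^ k) a \<noteq> a"
    unfolding m_def by (rule funpow_dist1_least)
  have inj: "inj_on (\<lambda>k. (g ^^ k) a) {..<m}"
  proof (rule linorder_inj_onI)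
    fix i j :: nat assume "i < j" "i \<in> {..<m}" "j \<in> {..<m}"
    show "(g ^^ i) a \<noteq> (g ^^ j) a"
    proof
      assume eq: "(g ^^ i) a = (g ^^ j) a"
      have "(g ^^ j) a = (g ^^ i) ((g ^^ (j - i)) a)"
        using funpow_add[of i "j - i" g] \<open>i < j\<close> by (simp add: fun_eq_iff)
      moreover have "inj (g ^^ i)"
        by (rule inj_fn[OF bij_is_inj[OF permutation_bijective[OF assms]]])
      ultimately have "(g ^^ (j - i)) a = a" using eq by (metis injD)
      then show False
        using least[of "j - i"] \<open>i < j\<close> \<open>j \<in> {..<m}\<close> by (auto simp: less_imp_diff_less)
    qed
  qed auto
  have ex: "orbit g a = (\<lambda>k. (g ^^ k) a) ` {..<m}"
    using orbit_altdef_bounded[OF m(2,1)] by auto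
  then have card: "card (orbit g a) = m"
    using card_image[OF inj] by simp
  show "(g ^^ card (orbit g a)) a = a" using m card by simp
  show "0 < k \<Longrightarrow> k < card (orbit g a) \<Longrightarrow> (g ^^ k) a \<noteq> a" using least card by simp
  show "b \<in> orbit g a \<Longrightarrow> \<exists>k < card (orbit g a). (g ^^ k) a = b"
    unfolding card unfolding ex by auto
qed

text \<open>Faces depend only on the two permutations, so this level mentions no vertices. Its facts
  serve the fullerene, the expansion and the parent alike.\<close>

locale rotation_system =
  fixes X :: "('v, 'a) embedded_graph"
  assumes finite_arcs: "finite (arcs (skel X))"
    and rot_perm: "rot X permutes arcs (skel X)"
    and opp_perm: "opp X permutes arcs (skel X)"
    and opp_opp: "\<And>a. a \<in> arcs (skel X) \<Longrightarrow> opp X (opp X a) = a"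
    and opp_neq: "\<And>a. a \<in> arcs (skel X) \<Longrightarrow> opp X a \<noteq> a"
begin

abbreviation "ars \<equiv> arcs (skel X)"

lemma opp_opp' [simp]: "opp X (opp X a) = a"
  by (metis opp_opp opp_perm permutes_not_in)

lemma opp_in_iff [simp]: "opp X a \<in> ars \<longleftrightarrow> a \<in> ars"
  by (rule permutes_in_image[OF opp_perm])

lemma rot_in_iff [simp]: "rot X a \<in> ars \<longleftrightarrow> a \<in> ars"
  by (rule permutes_in_image[OF rot_perm])

lemma inv_rot_rot [simp]: "inv (rot X) (rot X a) = a"
  by (rule permutes_inverses(2)[OF rot_perm])

lemma rot_inv_rot [simp]: "rot X (inv (rot X) a) = a"
  by (rule permutes_inverses(1)[OF rot_perm])

lemma face_succ_permutes: "face_succ X permutes ars"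
proof -
  have "face_succ X = inv (rot X) \<circ> opp X"
    by (auto simp: face_succ_def)
  then show ?thesis
    using permutes_compose[OF opp_perm permutes_inv[OF rot_perm]] by simp
qed

lemma face_succ_permutation: "permutation (face_succ X)"
  using face_succ_permutes finite_arcs by (auto simp: permutation_permutes)

lemma face_succ_in_iff [simp]: "face_succ X a \<in> ars \<longleftrightarrow> a \<in> ars"
  by (rule permutes_in_image[OF face_succ_permutes])

lemma face_succ_eq_iff [simp]: "face_succ X a = face_succ X b \<longleftrightarrow> a = b"
  by (metis face_succ_permutes permutes_inj injD)

lemma face_succ_iff: "face_succ X a = b \<longleftrightarrow> opp X a = rot X b"
  by (auto simp: face_succ_def)

lemma self_in_face_at [simp]: "a \<in> face_at X a"
  unfolding face_at_def by (rule permutation_self_in_orbit[OF face_succ_permutation])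

lemma face_at_face_succ [simp]: "face_at X (face_succ X a) = face_at X a"
  unfolding face_at_def by (rule permutation_orbit_step[OF face_succ_permutation])

text \<open>One step of \<open>face_succ X\<close> from \<open>opp X a\<close> turns into the arc
  clockwise before \<open>a\<close>. Right-hand faces can thus always be expressed as left-hand
  faces at the same vertex.\<close>

lemma face_at_opp: "face_at X (opp X a) = face_at X (inv (rot X) a)"
  using face_at_face_succ[of "opp X a"] by (simp add: face_succ_def)

lemma in_face_at_iff: "b \<in> face_at X a \<longleftrightarrow> face_at X b = face_at X a"
proof
  assume "b \<in> face_at X a"
  then show "face_at X b = face_at X a"
    unfolding face_at_def
    using orbit_cyclic_eq3[OF cyclic_on_orbit'[OF face_succ_permutation]] by blast
next
  assume "face_at X b = face_at X a"
  then show "b \<in> face_at X a" using self_in_face_at[of b] by simp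
qed

lemma face_at_subset: "a \<in> ars \<Longrightarrow> face_at X a \<subseteq> ars"
  unfolding face_at_def by (rule permutes_orbit_subset[OF face_succ_permutes])

lemma face_subset: "f \<in> faces X \<Longrightarrow> f \<subseteq> ars"
  by (auto simp: faces_def dest: face_at_subset)

lemma face_at_in_faces [simp]: "a \<in> ars \<Longrightarrow> face_at X a \<in> faces X"
  by (simp add: faces_def)

lemma in_face_iff: "f \<in> faces X \<Longrightarrow> b \<in> f \<longleftrightarrow> face_at X b = f"
  using in_face_at_iff unfolding faces_def by blast

lemma face_nonempty: "f \<in> faces X \<Longrightarrow> f \<noteq> {}"
  by (metis empty_iff faces_def imageE self_in_face_at)

lemma finite_face: "f \<in> faces X \<Longrightarrow> finite f"
  by (meson face_subset finite_arcs finite_subset)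

lemma finite_faces: "finite (faces X)"
  by (simp add: faces_def finite_arcs)

lemma face_eqI: "f \<in> faces X \<Longrightarrow> b \<in> f \<Longrightarrow> face_at X b = f"
  by (simp add: in_face_iff)

lemma card_Union_faces: "S \<subseteq> faces X \<Longrightarrow> card (\<Union> S) = (\<Sum>f\<in>S. card f)"
  by (rule card_Union_disjoint)
     (auto simp: pairwise_def disjnt_def in_face_iff finite_face subset_iff)

lemma Union_faces: "\<Union> (faces X) = ars"
  using face_subset by (auto simp: faces_def)

lemma face_succ_in_face_iff [simp]: "f \<in> faces X \<Longrightarrow> face_succ X a \<in> f \<longleftrightarrow> a \<in> f"
  by (simp add: in_face_iff)

lemma face_succ_image: "f \<in> faces X \<Longrightarrow> face_succ X ` f = f"
  by (rule endo_inj_surj) (auto simp: finite_face inj_on_def)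

lemma face_funpow:
  assumes "f \<in> faces X" "a \<in> f"
  shows "(face_succ X ^^ card f) a = a"
    and "0 < k \<Longrightarrow> k < card f \<Longrightarrow> (face_succ X ^^ k) a \<noteq> a"
    and "b \<in> f \<Longrightarrow> \<exists>k < card f. (face_succ X ^^ k) a = b"
proof -
  have f: "orbit (face_succ X) a = f" using face_eqI[OF assms] by (simp add: face_at_def)
  note o = orbit_funpow[OF face_succ_permutation, where a = a, unfolded f]
  show "(face_succ X ^^ card f) a = a" by (rule o)
  show "0 < k \<Longrightarrow> k < card f \<Longrightarrow> (face_succ X ^^ k) a \<noteq> a" by (rule o)
  show "b \<in> f \<Longrightarrow> \<exists>k < card f. (face_succ X ^^ k) a = b" by (rule o)
qed

end

section \<open>Simple connected maps: arcs, edges and induction over all arcs\<close>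

lemma graph_reachable_of_connected:
  assumes "graph G" "Digraph_Component.connected G" "u \<in> verts G" "v \<in> verts G"
  shows "u \<rightarrow>\<^sup>*\<^bsub>G\<^esub> v"
proof -
  interpret graph G by fact
  have "u \<rightarrow>\<^sup>*\<^bsub>mk_symmetric G\<^esub> v"
    using assms by (auto simp: connected_def strongly_connected_def)
  then show ?thesis by (simp add: reachable_mk_symmetric_eq[OF sym_arcs])
qed

text \<open>This part of \<open>connected_plane_graph\<close> is separate because the parent is
  shown to satisfy it first; its consequences, such as the count of arcs, then help to establish
  connectedness and Euler's formula.\<close>

locale simple_rotation_system =
  fixes X :: "('v, 'a) embedded_graph"
  assumes simple_graph: "graph (skel X)"
    and opposite: "bidirected_digraph (skel X) (opp X)"
    and rot_permutes: "rot X permutes arcs (skel X)"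

sublocale simple_rotation_system \<subseteq> rotation_system X
proof -
  interpret graph "skel X" by (rule simple_graph)
  interpret O: bidirected_digraph "skel X" "opp X" by (rule opposite)
  show "rotation_system X"
    by unfold_locales (auto simp: rot_permutes O.arev_permutes_arcs O.arev_neq)
qed

context simple_rotation_system
begin

lemma tail_opp: "a \<in> ars \<Longrightarrow> tail (skel X) (opp X a) = head (skel X) a"
  by (rule bidirected_digraph.tail_arev[OF opposite])

lemma head_opp: "a \<in> ars \<Longrightarrow> head (skel X) (opp X a) = tail (skel X) a"
  by (rule bidirected_digraph.head_arev[OF opposite])

lemma edge_of_opp: "a \<in> ars \<Longrightarrow> edge_of X (opp X a) = edge_of X a"
  by (auto simp: edge_of_def tail_opp head_opp)

lemma tail_in_verts: "a \<in> ars \<Longrightarrow> tail (skel X) a \<in> verts (skel X)"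
  using simple_graph
  by (metis graph_def digraph_def loopfree_digraph_def wf_digraph.tail_in_verts)

lemma head_in_verts: "a \<in> ars \<Longrightarrow> head (skel X) a \<in> verts (skel X)"
  using tail_in_verts[of "opp X a"] by (simp add: tail_opp)

lemma finite_verts: "finite (verts (skel X))"
  using simple_graph by (metis graph_def digraph_def fin_digraph.finite_verts)

lemma tail_neq_head: "a \<in> ars \<Longrightarrow> tail (skel X) a \<noteq> head (skel X) a"
  using simple_graph by (metis graph_def digraph_def loopfree_digraph.no_loops)

lemma arc_eqI:
  "a \<in> ars \<Longrightarrow> b \<in> ars \<Longrightarrow> tail (skel X) a = tail (skel X) b \<Longrightarrow>
   head (skel X) a = head (skel X) b \<Longrightarrow> a = b"
  using simple_graph
  by (metis graph_def digraph_def nomulti_digraph.no_multi_arcs arc_to_ends_def)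

lemma edge_of_eq_iff:
  "a \<in> ars \<Longrightarrow> b \<in> ars \<Longrightarrow> edge_of X a = edge_of X b \<longleftrightarrow> a = b \<or> a = opp X b"
  using arc_eqI[of a b] arc_eqI[of a "opp X b"]
  by (auto simp: edge_of_def doubleton_eq_iff tail_opp head_opp)

lemma finite_edges: "finite (edges X)"
  by (simp add: edges_def finite_arcs)

lemma card_ars: "card ars = 2 * card (edges X)"
proof -
  have "card ars = (\<Sum>e\<in>edges X. card {a \<in> ars. edge_of X a = e})"
    using sum.image_gen[OF finite_arcs, of "\<lambda>_. 1::nat" "edge_of X"] by (simp add: edges_def)
  also have "\<dots> = (\<Sum>e\<in>edges X. 2)"
  proof (rule sum.cong[OF refl])
    fix e assume "e \<in> edges X"
    then obtain a where a: "a \<in> ars" "e = edge_of X a" by (auto simp: edges_def)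
    then have "{b \<in> ars. edge_of X b = e} = {a, opp X a}"
      using edge_of_eq_iff[OF _ a(1)] by (auto simp: edge_of_opp)
    then show "card {b \<in> ars. edge_of X b = e} = 2"
      using opp_neq[OF a(1)] by simp
  qed
  finally show ?thesis by simp
qed

end

sublocale connected_plane_graph \<subseteq> simple_rotation_system X
  by (intro simple_rotation_system.intro simple_graph opposite rot_permutes)

context connected_plane_graph
begin

lemma out_arcs_eq_orbit: "a \<in> ars \<Longrightarrow> out_arcs (skel X) (tail (skel X) a) = orbit (rot X) a"
proof -
  assume a: "a \<in> ars"
  then have "a \<in> out_arcs (skel X) (tail (skel X) a)" by simp
  then show ?thesis using rot_cyclic[OF tail_in_verts[OF a]] orbit_cyclic_eq3 by (metis empty_iff)
qed

lemma tail_rot: "a \<in> ars \<Longrightarrow> tail (skel X) (rot X a) = tail (skel X) a"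
proof -
  assume "a \<in> ars"
  then have "rot X a \<in> out_arcs (skel X) (tail (skel X) a)"
    unfolding out_arcs_eq_orbit[OF \<open>a \<in> ars\<close>] by (intro orbit.base)
  then show ?thesis by simp
qed

lemma reachable_verts: "u \<in> verts (skel X) \<Longrightarrow> v \<in> verts (skel X) \<Longrightarrow> u \<rightarrow>\<^sup>*\<^bsub>skel X\<^esub> v"
  by (rule graph_reachable_of_connected[OF simple_graph conn])

text \<open>Rotations are cyclic at each vertex and the graph is connected, so \<open>rot\<close>
  and \<open>opp\<close> act transitively on the arcs. This carries the connectedness of the dual
  graph, the closing up of the rings and the connectedness of the parent.\<close>

lemma arcs_closed_induct [consumes 2, case_names rot opp]:
  assumes "b \<in> ars" "a \<in> ars" "P a"
    and rot: "\<And>a. a \<in> ars \<Longrightarrow> P a \<Longrightarrow> P (rot X a)"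
    and opp: "\<And>a. a \<in> ars \<Longrightarrow> P a \<Longrightarrow> P (opp X a)"
  shows "P b"
proof -
  interpret graph "skel X" by (rule simple_graph)
  have orb: "P c" if "P a" "a \<in> ars" "c \<in> ars" "tail (skel X) c = tail (skel X) a" for a c
  proof -
    have "c \<in> out_arcs (skel X) (tail (skel X) a)" using that by simp
    then have "c \<in> orbit (rot X) a" unfolding out_arcs_eq_orbit[OF \<open>a \<in> ars\<close>] .
    then have "P c \<and> c \<in> ars"
    proof induct
      case base
      then show ?case using rot[OF that(2,1)] that by simp
    next
      case (step y)
      then show ?case using rot[of y] by simp
    qed
    then show ?thesis by simp
  qed
  have "tail (skel X) a \<rightarrow>\<^sup>*\<^bsub>skel X\<^esub> tail (skel X) b"
    using assms(1,2) by (simp add: reachable_verts tail_in_verts)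
  then have "\<forall>c\<in>ars. tail (skel X) c = tail (skel X) b \<longrightarrow> P c"
  proof (induct rule: reachable_induct)
    case base
    show ?case using orb[OF assms(3,2)] by blast
  next
    case (step x y)
    from step(2) obtain e where e: "e \<in> ars" "tail (skel X) e = x" "head (skel X) e = y"
      by (auto simp: arcs_ends_conv)
    then have "P (opp X e)" using step(3) opp by blast
    moreover have "opp X e \<in> ars" "tail (skel X) (opp X e) = y" using e by (auto simp: tail_opp)
    ultimately show ?case using orb[of "opp X e"] by metis
  qed
  then show ?thesis using assms(1) by blast
qed

end

section \<open>Edge sets that are even on every face\<close>

text \<open>
  A combinatorial Jordan curve theorem, by counting in the cycle space modulo 2: there are
  \<open>2 ^ (|V| - 1)\<close> cuts, all of them even on every face, and since the dual graph is connected there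
  are at most \<open>2 ^ (|E| - |F| + 1)\<close> edge sets that are even on every face. By Euler's formula
  the two numbers agree.
\<close>

lemma odd_card_sym_diff:
  assumes "finite A" "finite B"
  shows "odd (card (sym_diff A B)) \<longleftrightarrow> odd (card A) \<noteq> odd (card B)"
proof -
  have "card (sym_diff A B) = card (A - B) + card (B - A)"
    using assms by (intro card_Un_disjoint) auto
  moreover have "card A = card (A - B) + card (A \<inter> B)" "card B = card (B - A) + card (A \<inter> B)"
    using assms card_Diff_subset_Int[of A B] card_Diff_subset_Int[of B A]
    by (simp_all add: Int_commute card_mono)
  ultimately show ?thesis by presburger
qed

text \<open>Rank and nullity over the field with two elements: subsets form a vector space under
  symmetric difference, \<open>h\<close> is linear, and each nonempty fibre is a translate of the
  kernel.\<close>

lemma card_image_times_kernel: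
  assumes "finite U"
    and add: "\<And>A B. A \<subseteq> U \<Longrightarrow> B \<subseteq> U \<Longrightarrow> h (sym_diff A B) = sym_diff (h A) (h B)"
  shows "card (h ` Pow U) * card {A \<in> Pow U. h A = {}} = 2 ^ card U"
proof -
  have "2 ^ card U = card (Pow U)" using assms by (simp add: card_Pow)
  also have "\<dots> = (\<Sum>T\<in>h ` Pow U. card {A \<in> Pow U. h A = T})"
    using sum.image_gen[of "Pow U" "\<lambda>_. 1::nat" h] assms by simp
  also have "\<dots> = (\<Sum>T\<in>h ` Pow U. card {A \<in> Pow U. h A = {}})"
  proof (rule sum.cong[OF refl])
    fix T assume "T \<in> h ` Pow U"
    then obtain B where B: "B \<subseteq> U" "T = h B" by auto
    have "bij_betw (\<lambda>A. sym_diff A B) {A \<in> Pow U. h A = T} {A \<in> Pow U. h A = {}}"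
    proof (rule bij_betw_byWitness[where f' = "\<lambda>A. sym_diff A B"])
      have inv: "sym_diff (sym_diff A B) B = A" for A by blast
      show "\<forall>A\<in>{A \<in> Pow U. h A = T}. sym_diff (sym_diff A B) B = A"
        "\<forall>A\<in>{A \<in> Pow U. h A = {}}. sym_diff (sym_diff A B) B = A"
        using inv by blast+
      show "(\<lambda>A. sym_diff A B) ` {A \<in> Pow U. h A = T} \<subseteq> {A \<in> Pow U. h A = {}}"
        "(\<lambda>A. sym_diff A B) ` {A \<in> Pow U. h A = {}} \<subseteq> {A \<in> Pow U. h A = T}"
        using B add by auto
    qed
    then show "card {A \<in> Pow U. h A = T} = card {A \<in> Pow U. h A = {}}"
      by (rule bij_betw_same_card)
  qed
  finally show ?thesis by simp
qed

context connected_plane_graph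
begin

text \<open>The coboundary map modulo 2 from vertex sets to edge sets. Together with
  \<open>odd_faces\<close> it forms a complex, and its exactness at the edge sets is the vanishing
  of the first cohomology of the sphere.\<close>

definition cut :: "'v set \<Rightarrow> 'v set set" where
  "cut S = {e \<in> edges X. odd (card (e \<inter> S))}"

text \<open>Arcs are counted rather than edges, so an edge with the same face on both sides counts
  twice and cancels.\<close>

definition odd_faces :: "'v set set \<Rightarrow> 'a set set" where
  "odd_faces D = {f \<in> faces X. odd (card {a \<in> f. edge_of X a \<in> D})}"

lemma finite_edge: "e \<in> edges X \<Longrightarrow> finite e"
  by (auto simp: edges_def edge_of_def)

lemma edge_of_in_edges: "a \<in> ars \<Longrightarrow> edge_of X a \<in> edges X"
  by (simp add: edges_def)

lemma edge_of_in_cut_iff: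
  assumes "a \<in> ars"
  shows "edge_of X a \<in> cut S \<longleftrightarrow> (tail (skel X) a \<in> S) \<noteq> (head (skel X) a \<in> S)"
  using tail_neq_head[OF assms] edge_of_in_edges[OF assms]
  by (auto simp: cut_def edge_of_def Int_insert_left)

lemma cut_sym_diff: "cut (sym_diff A B) = sym_diff (cut A) (cut B)"
proof -
  have "odd (card (e \<inter> sym_diff A B)) \<longleftrightarrow> odd (card (e \<inter> A)) \<noteq> odd (card (e \<inter> B))"
    if "e \<in> edges X" for e
  proof -
    have "e \<inter> sym_diff A B = sym_diff (e \<inter> A) (e \<inter> B)" by blast
    then show ?thesis using odd_card_sym_diff[of "e \<inter> A" "e \<inter> B"] finite_edge[OF that] by simp
  qed
  then show ?thesis unfolding cut_def by blast
qed

lemma odd_faces_sym_diff: "odd_faces (sym_diff A B) = sym_diff (odd_faces A) (odd_faces B)"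
proof -
  have "odd (card {a \<in> f. edge_of X a \<in> sym_diff A B}) \<longleftrightarrow>
      odd (card {a \<in> f. edge_of X a \<in> A}) \<noteq> odd (card {a \<in> f. edge_of X a \<in> B})"
    if "f \<in> faces X" for f
  proof -
    have "{a \<in> f. edge_of X a \<in> sym_diff A B} =
        sym_diff {a \<in> f. edge_of X a \<in> A} {a \<in> f. edge_of X a \<in> B}" by blast
    then show ?thesis using odd_card_sym_diff[of "{a \<in> f. edge_of X a \<in> A}" "{a \<in> f. edge_of X a \<in> B}"]
        finite_face[OF that] by simp
  qed
  then show ?thesis unfolding odd_faces_def by blast
qed

lemma tail_face_succ: "a \<in> ars \<Longrightarrow> tail (skel X) (face_succ X a) = head (skel X) a"
  using tail_rot[of "face_succ X a"] face_succ_iff[of a "face_succ X a"] by (simp add: tail_opp[symmetric])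

text \<open>On a face, the arcs of the cut form the symmetric difference of those with tail in
  \<open>S\<close> and those with head in \<open>S\<close>; \<open>face_succ X\<close> maps the
  latter onto the former, so the two sets have the same size.\<close>

lemma odd_faces_cut: "odd_faces (cut S) = {}"
proof -
  have "even (card {a \<in> f. edge_of X a \<in> cut S})" if f: "f \<in> faces X" for f
  proof -
    let ?T = "{a \<in> f. tail (skel X) a \<in> S}" and ?U = "{a \<in> f. head (skel X) a \<in> S}"
    have ars: "a \<in> ars" if "a \<in> f" for a using face_subset[OF f] that by blast
    have "{a \<in> f. edge_of X a \<in> cut S} = sym_diff ?T ?U"
      using ars edge_of_in_cut_iff by blast
    moreover have "face_succ X ` ?U = ?T"
    proof (intro equalityI subsetI)
      fix b assume "b \<in> ?T"
      then obtain a where "a \<in> f" "b = face_succ X a" using face_succ_image[OF f] by blast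
      then show "b \<in> face_succ X ` ?U" using \<open>b \<in> ?T\<close> ars tail_face_succ by auto
    qed (use f ars tail_face_succ in auto)
    then have "card ?T = card ?U"
      by (metis (no_types, lifting) card_image face_succ_eq_iff inj_onI)
    ultimately show ?thesis
      using odd_card_sym_diff[of ?T ?U] finite_face[OF f] by simp
  qed
  then show ?thesis by (auto simp: odd_faces_def)
qed

lemma cut_kernel: "cut S = {} \<Longrightarrow> S \<subseteq> verts (skel X) \<Longrightarrow> S = {} \<or> S = verts (skel X)"
proof -
  assume S: "cut S = {}" "S \<subseteq> verts (skel X)"
  interpret graph "skel X" by (rule simple_graph)
  have "v \<in> S" if u: "u \<in> S" and v: "v \<in> verts (skel X)" for u v
  proof -
    have "u \<rightarrow>\<^sup>*\<^bsub>skel X\<^esub> v" using u v S(2) by (intro reachable_verts) auto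
    then show ?thesis
    proof (induct rule: reachable_induct)
      case base show ?case by (rule u)
    next
      case (step x y)
      from step(2) obtain e where e: "e \<in> ars" "tail (skel X) e = x" "head (skel X) e = y"
        by (auto simp: arcs_ends_conv)
      then show ?case using step(3) edge_of_in_cut_iff[OF e(1), of S] S(1) by simp
    qed
  qed
  then show ?thesis using S(2) by blast
qed

lemma odd_faces_edge:
  assumes "a \<in> ars"
  shows "odd_faces {edge_of X a} = sym_diff {face_at X a} {face_at X (opp X a)}"
proof -
  have a': "opp X a \<in> ars" using assms by simp
  have *: "{b \<in> f. edge_of X b \<in> {edge_of X a}} = {a, opp X a} \<inter> f" if f: "f \<in> faces X" for f
    using face_subset[OF f] edge_of_eq_iff[OF _ assms] assms by (auto simp: edge_of_opp)
  have odd: "odd (card ({a, opp X a} \<inter> f)) \<longleftrightarrow> (a \<in> f) \<noteq> (opp X a \<in> f)" for f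
    using opp_neq[OF assms] by (cases "a \<in> f"; cases "opp X a \<in> f") simp_all
  show ?thesis
  proof (rule set_eqI)
    fix f
    have "f \<in> odd_faces {edge_of X a} \<longleftrightarrow> f \<in> faces X \<and> (a \<in> f) \<noteq> (opp X a \<in> f)"
    proof (cases "f \<in> faces X")
      case True
      then show ?thesis unfolding odd_faces_def mem_Collect_eq *[OF True] odd by simp
    qed (simp add: odd_faces_def)
    also have "\<dots> \<longleftrightarrow> (face_at X a = f) \<noteq> (face_at X (opp X a) = f)"
      using in_face_iff[of f a] in_face_iff[of f "opp X a"]
        face_at_in_faces[OF assms] face_at_in_faces[OF a'] by metis
    finally show "f \<in> odd_faces {edge_of X a} \<longleftrightarrow>
        f \<in> sym_diff {face_at X a} {face_at X (opp X a)}"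
      by (simp add: eq_commute[of f]) blast
  qed
qed

text \<open>Connectedness of the dual graph puts every pair of a face with the fixed face
  \<open>?f0\<close> into the image. Hence each set of faces lies in the image either as it is or
  after toggling \<open>?f0\<close>, and the image has index at most 2.\<close>

lemma card_image_odd_faces: "2 ^ card (faces X) \<le> 2 * card (odd_faces ` Pow (edges X))"
proof -
  let ?I = "odd_faces ` Pow (edges X)"
  have finI: "finite ?I" by (simp add: finite_edges)
  have "odd_faces {} = {}" by (simp add: odd_faces_def)
  then have zero: "{} \<in> ?I" by (metis Pow_bottom imageI)
  have closed: "sym_diff A B \<in> ?I" if "A \<in> ?I" "B \<in> ?I" for A B
  proof -
    from that(1) obtain D where D: "A = odd_faces D" "D \<in> Pow (edges X)" by (rule imageE)
    from that(2) obtain D' where D': "B = odd_faces D'" "D' \<in> Pow (edges X)" by (rule imageE)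
    have "odd_faces (sym_diff D D') \<in> ?I" using D D' by (intro imageI) auto
    then show ?thesis by (simp only: odd_faces_sym_diff D D')
  qed
  show ?thesis
  proof (cases "ars = {}")
    case True
    then have "faces X = {}" by (simp add: faces_def)
    moreover have "0 < card ?I" using finI zero by (metis card_gt_0_iff empty_iff)
    ultimately show ?thesis by simp
  next
    case False
    then obtain a0 where a0: "a0 \<in> ars" by blast
    let ?f0 = "face_at X a0"
    have pair: "sym_diff {face_at X a} {?f0} \<in> ?I" if "a \<in> ars" for a
    proof (rule arcs_closed_induct[OF that a0])
      show "sym_diff {?f0} {?f0} \<in> ?I" using zero by simp
    next
      fix a assume a: "a \<in> ars" "sym_diff {face_at X a} {?f0} \<in> ?I"
      have "sym_diff {face_at X a} {face_at X (opp X a)} \<in> ?I"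
        unfolding odd_faces_edge[OF a(1), symmetric] using edge_of_in_edges[OF a(1)] by simp
      from closed[OF a(2) this]
      have "sym_diff (sym_diff {face_at X a} {?f0}) (sym_diff {face_at X a} {face_at X (opp X a)}) \<in> ?I" .
      moreover have "sym_diff (sym_diff {face_at X a} {?f0}) (sym_diff {face_at X a} {face_at X (opp X a)})
        = sym_diff {face_at X (opp X a)} {?f0}" by blast
      ultimately show "sym_diff {face_at X (opp X a)} {?f0} \<in> ?I" by simp
    next
      fix a assume a: "a \<in> ars" "sym_diff {face_at X a} {?f0} \<in> ?I"
      \<comment> \<open>The edge of \<open>?b\<close> separates the face of \<open>?b\<close> from
        that of \<open>a\<close>, so toggling it passes from one to the other.\<close>
      let ?b = "rot X a"
      have eq: "face_at X (opp X ?b) = face_at X a" by (simp add: face_at_opp)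
      have b: "?b \<in> ars" using a(1) by simp
      have "sym_diff {face_at X ?b} {face_at X a} \<in> ?I"
        unfolding odd_faces_edge[OF b, unfolded eq, symmetric] using edge_of_in_edges[OF b] by simp
      from closed[OF a(2) this]
      have "sym_diff (sym_diff {face_at X a} {?f0}) (sym_diff {face_at X ?b} {face_at X a}) \<in> ?I" .
      moreover have "sym_diff (sym_diff {face_at X a} {?f0}) (sym_diff {face_at X ?b} {face_at X a})
        = sym_diff {face_at X ?b} {?f0}" by blast
      ultimately show "sym_diff {face_at X ?b} {?f0} \<in> ?I" by simp
    qed
    have "T \<in> ?I \<or> sym_diff T {?f0} \<in> ?I" if "T \<subseteq> faces X" for T
    proof -
      have "finite T" using that finite_faces finite_subset by blast
      then show ?thesis using that
      proof induct
        case empty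
        then show ?case using zero by simp
      next
        case (insert f T)
        then obtain a where a: "a \<in> ars" "f = face_at X a" by (auto simp: faces_def)
        have p: "sym_diff {f} {?f0} \<in> ?I" using pair[OF a(1)] a by simp
        have f: "f \<notin> T" by (rule insert)
        have "T \<in> ?I \<or> sym_diff T {?f0} \<in> ?I" using insert by simp
        then show ?case
        proof
          assume "T \<in> ?I"
          from closed[OF this p] have "sym_diff T (sym_diff {f} {?f0}) \<in> ?I" .
          moreover have "sym_diff T (sym_diff {f} {?f0}) = sym_diff (insert f T) {?f0}"
            using f by blast
          ultimately show ?thesis by simp
        next
          assume "sym_diff T {?f0} \<in> ?I"
          from closed[OF this p] have "sym_diff (sym_diff T {?f0}) (sym_diff {f} {?f0}) \<in> ?I" .
          moreover have "sym_diff (sym_diff T {?f0}) (sym_diff {f} {?f0}) = insert f T"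
            using f by blast
          ultimately show ?thesis by simp
        qed
      qed
    qed
    note half = this
    have sub: "Pow (faces X) \<subseteq> ?I \<union> (\<lambda>T. sym_diff T {?f0}) ` ?I"
    proof (intro subsetI)
      fix T assume "T \<in> Pow (faces X)"
      then have "T \<in> ?I \<or> sym_diff T {?f0} \<in> ?I"
        by (intro half) simp
      moreover have "sym_diff (sym_diff T {?f0}) {?f0} = T" by blast
      ultimately show "T \<in> ?I \<union> (\<lambda>T. sym_diff T {?f0}) ` ?I"
        using imageI[of "sym_diff T {?f0}" ?I "\<lambda>T. sym_diff T {?f0}"] by (elim disjE) simp_all
    qed
    have "2 ^ card (faces X) = card (Pow (faces X))"
      by (simp add: card_Pow finite_faces)
    also have "\<dots> \<le> card (?I \<union> (\<lambda>T. sym_diff T {?f0}) ` ?I)"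
      by (rule card_mono[OF _ sub]) (use finI in blast)
    also have "\<dots> \<le> card ?I + card ((\<lambda>T. sym_diff T {?f0}) ` ?I)"
      by (rule card_Un_le)
    also have "\<dots> \<le> 2 * card ?I"
      using card_image_le[OF finI] by (simp add: mult_2)
    finally show ?thesis .
  qed
qed

theorem even_on_faces_imp_cut:
  assumes D: "D \<subseteq> edges X" and even: "\<And>f. f \<in> faces X \<Longrightarrow> even (card {a \<in> f. edge_of X a \<in> D})"
  shows "\<exists>S \<subseteq> verts (skel X). D = cut S"
proof -
  let ?C = "cut ` Pow (verts (skel X))" and ?Z = "{D \<in> Pow (edges X). odd_faces D = {}}"
    and ?I = "odd_faces ` Pow (edges X)"
  have sub: "?C \<subseteq> ?Z" using odd_faces_cut by (auto simp: cut_def)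
  have finZ: "finite ?Z" by (simp add: finite_edges)
  have "card {S \<in> Pow (verts (skel X)). cut S = {}} \<le> card {{}, verts (skel X)}"
    by (rule card_mono) (use cut_kernel in auto)
  also have "\<dots> \<le> 2" by (simp add: card_insert_if)
  finally have ker: "card {S \<in> Pow (verts (skel X)). cut S = {}} \<le> 2" .
  have "2 ^ card (verts (skel X)) \<le> 2 * card ?C"
    using card_image_times_kernel[OF finite_verts cut_sym_diff] mult_le_mono2[OF ker, of "card ?C"]
    by simp
  \<comment> \<open>The factor for the faces brings V + F into the exponent, where Euler's formula
    replaces it by E + 2.\<close>
  then have "2 ^ (card (verts (skel X)) + card (faces X)) \<le> (2 * card ?C) * 2 ^ card (faces X)"
    by (simp add: power_add)
  moreover have "card (verts (skel X)) + card (faces X) = card (edges X) + 2"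
    using euler by linarith
  ultimately have "4 * 2 ^ card (edges X) \<le> 2 * card ?C * 2 ^ card (faces X)"
    by (simp add: power_add)
  moreover have "2 ^ card (edges X) = card ?I * card ?Z"
    using card_image_times_kernel[OF finite_edges odd_faces_sym_diff] by simp
  moreover have "2 ^ card (faces X) * card ?Z \<le> 2 * card ?I * card ?Z"
    by (rule mult_le_mono1[OF card_image_odd_faces])
  ultimately have "2 * (2 ^ card (faces X) * card ?Z) \<le> 2 * (card ?C * 2 ^ card (faces X))"
    by linarith
  then have "card ?Z \<le> card ?C" by (simp add: mult.commute)
  then have "?C = ?Z" by (rule card_seteq[OF finZ sub])
  moreover have "D \<in> ?Z" using assms by (auto simp: odd_faces_def)
  ultimately have "D \<in> ?C" by simp
  then obtain S where "D = cut S" "S \<in> Pow (verts (skel X))" by (rule imageE)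
  then show ?thesis by (intro exI[of _ S]) simp
qed

text \<open>The set of all edges is even on every face, hence it is a cut, and the two sides of this
  cut are the partite sets.\<close>

theorem even_faces_imp_bipartition:
  assumes "\<And>f. f \<in> faces X \<Longrightarrow> even (card f)"
  shows "\<exists>A B. bipartition X A B"
proof -
  have "even (card {a \<in> f. edge_of X a \<in> edges X})" if f: "f \<in> faces X" for f
  proof -
    have "{a \<in> f. edge_of X a \<in> edges X} = f"
      using face_subset[OF f] edge_of_in_edges by blast
    then show ?thesis using assms[OF f] by simp
  qed
  from even_on_faces_imp_cut[OF subset_refl this]
  obtain S where S: "S \<subseteq> verts (skel X)" "edges X = cut S" by blast
  have "\<exists>u\<in>S. \<exists>v\<in>verts (skel X) - S. e = {u, v}" if e: "e \<in> edges X" for e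
  proof -
    obtain a where a: "a \<in> ars" "e = edge_of X a" using e by (auto simp: edges_def)
    then have "(tail (skel X) a \<in> S) \<noteq> (head (skel X) a \<in> S)"
      using edge_of_in_cut_iff[OF a(1), of S] S(2) e by simp
    moreover have "e = {tail (skel X) a, head (skel X) a}" "e = {head (skel X) a, tail (skel X) a}"
      using a(2) by (simp_all add: edge_of_def insert_commute)
    ultimately show ?thesis
      using tail_in_verts[OF a(1)] head_in_verts[OF a(1)] by (metis DiffI)
  qed
  then have "bipartition X S (verts (skel X) - S)"
    using S(1) unfolding bipartition_def by (intro conjI ballI) (blast | simp)+
  then show ?thesis by blast
qed

end

section \<open>Two faces of a fullerene share at most one edge\<close>

text \<open>With \<open>rot X\<close> of order three, the inverse rotation is \<open>rot X\<close>
  applied twice. Every face step then becomes a word in \<open>rot X\<close> and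
  \<open>opp X\<close> that rewriting can normalise.\<close>

locale trivalent_map = rotation_system X for X :: "('v, 'a) embedded_graph" +
  assumes rot_rot_rot_arc: "\<And>a. a \<in> arcs (skel X) \<Longrightarrow> rot X (rot X (rot X a)) = a"
begin

lemma rot_rot_rot [simp]: "rot X (rot X (rot X a)) = a"
  by (metis permutes_not_in rot_perm rot_rot_rot_arc)

lemma inv_rot: "inv (rot X) a = rot X (rot X a)"
  by (metis inv_rot_rot rot_rot_rot)

lemma face_succ_eq: "face_succ X a = rot X (rot X (opp X a))"
  by (simp add: face_succ_def inv_rot)

lemma face_at_opp_eq: "face_at X (opp X a) = face_at X (rot X (rot X a))"
  by (simp add: face_at_opp inv_rot)

end

locale fullerene_map =
  fixes F :: "('v, 'a) embedded_graph"
  assumes fullerene: "fullerene F"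

sublocale fullerene_map \<subseteq> connected_plane_graph F
  using fullerene by (simp add: fullerene_def)

context fullerene_map
begin

abbreviation "r \<equiv> rot F"
abbreviation "o' \<equiv> opp F"
abbreviation "g \<equiv> face_succ F"
abbreviation "L \<equiv> face_at F"

lemma card_orbit_rot: "a \<in> ars \<Longrightarrow> card (orbit r a) = 3"
  using fullerene out_arcs_eq_orbit tail_in_verts
  by (metis fullerene_def degree_def out_degree_def)

lemma rot_rot_rot_neq:
  assumes "a \<in> ars"
  shows "r (r (r a)) = a \<and> r a \<noteq> a"
proof -
  have "permutation r" using rot_perm finite_arcs by (auto simp: permutation_permutes)
  note * = orbit_funpow(1,2)[OF this, where a = a, unfolded card_orbit_rot[OF assms]]
  show ?thesis using *(1) *(2)[of 1] by (simp add: numeral_eq_Suc)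
qed

end

sublocale fullerene_map \<subseteq> trivalent_map F
  by unfold_locales (simp add: rot_rot_rot_neq)

context fullerene_map
begin

lemma rot_neq: "a \<in> ars \<Longrightarrow> r a \<noteq> a"
  by (simp add: rot_rot_rot_neq)

lemma card_face: "f \<in> faces F \<Longrightarrow> card f = 5 \<or> card f = 6"
  using fullerene by (auto simp: fullerene_def polygon_def)

lemma inj_on_tail: "f \<in> faces F \<Longrightarrow> inj_on (tail (skel F)) f"
  using fullerene finite_face[of f]
  by (intro eq_card_imp_inj_on) (auto simp: fullerene_def polygon_def face_verts_def)

lemma face_at_eq_tail_eq:
  "a \<in> ars \<Longrightarrow> b \<in> ars \<Longrightarrow> L a = L b \<Longrightarrow> tail (skel F) a = tail (skel F) b \<Longrightarrow> a = b"
  using inj_on_tail[of "L a"] by (metis face_at_in_faces inj_onD self_in_face_at)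

text \<open>A face is bounded by a cycle and so passes each vertex only once; this keeps the three
  faces around a vertex distinct.\<close>

lemma face_at_rot_neq: "a \<in> ars \<Longrightarrow> L (r a) \<noteq> L a"
  using face_at_eq_tail_eq[of "r a" a] by (auto simp: tail_rot rot_neq)

lemma face_at_opp_neq: "a \<in> ars \<Longrightarrow> L (o' a) \<noteq> L a"
  using face_at_rot_neq[of "r (r a)"] by (auto simp: face_at_opp_eq)

lemma face_at_funpow: "L ((g ^^ k) a) = L a"
  by (induct k) simp_all

lemma card_ars_verts: "card ars = 3 * card (verts (skel F))"
proof -
  have "card ars = (\<Sum>v\<in>verts (skel F). card {a \<in> ars. tail (skel F) a = v})"
    using sum.group[OF finite_arcs finite_verts, of "tail (skel F)" "\<lambda>_. 1::nat"] tail_in_verts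
    by (simp add: image_subset_iff)
  also have "\<dots> = (\<Sum>v\<in>verts (skel F). 3)"
    using fullerene
    by (intro sum.cong refl) (auto simp: fullerene_def degree_def out_degree_def out_arcs_def)
  finally show ?thesis by simp
qed

text \<open>With hexagons only, counting arcs gives 2E = 3V = 6F and therefore V - E + F =
  0.\<close>

lemma not_all_hexagons: "\<exists>a\<in>ars. card (L a) \<noteq> 6"
proof (rule ccontr)
  assume "\<not> ?thesis"
  then have "card f = 6" if "f \<in> faces F" for f
    using that by (auto simp: faces_def)
  then have "card ars = 6 * card (faces F)"
    using card_Union_faces[of "faces F"] by (simp add: Union_faces)
  then show False using card_ars_verts card_ars euler by linarith
qed

text \<open>
  \<open>Y s\<close> contains one arc at each vertex of the ring \<open>s\<close>; premise \<open>opp\<close> says that the set of all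
  arcs at the rings is closed under reversal.
\<close>

lemma no_ring:
  assumes fin: "\<Sigma> \<noteq> {}" "\<And>s y. s \<in> \<Sigma> \<Longrightarrow> y \<in> Y s \<Longrightarrow> y \<in> ars" "\<And>s. s \<in> \<Sigma> \<Longrightarrow> Y s \<noteq> {}"
    and opp: "\<And>s y c. s \<in> \<Sigma> \<Longrightarrow> y \<in> Y s \<Longrightarrow> c \<in> {y, r y, r (r y)} \<Longrightarrow>
        \<exists>s\<in>\<Sigma>. \<exists>y\<in>Y s. o' c \<in> {y, r y, r (r y)}"
    and hex: "\<And>s y. s \<in> \<Sigma> \<Longrightarrow> y \<in> Y s \<Longrightarrow> card (L y) = 6 \<and> card (L (r y)) = 6 \<and> card (L (r (r y))) = 6"
  shows False
proof -
  let ?P = "\<lambda>c. \<exists>s\<in>\<Sigma>. \<exists>y\<in>Y s. c \<in> {y, r y, r (r y)}"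
  obtain s0 y0 where 0: "s0 \<in> \<Sigma>" "y0 \<in> Y s0" using fin by blast
  \<comment> \<open>The arcs at the rings are closed under rotation by their form and under reversal
    by \<open>opp\<close>, so they exhaust all arcs and every face becomes a hexagon.\<close>
  have P: "?P c" if "c \<in> ars" for c
  proof (rule arcs_closed_induct[where P = ?P, OF that])
    show "y0 \<in> ars" using 0 fin by blast
    show "?P y0" using 0 by blast
  next
    fix a assume "?P a"
    then obtain s y where sy: "s \<in> \<Sigma>" "y \<in> Y s" "a = y \<or> a = r y \<or> a = r (r y)" by blast
    then have "r a \<in> {y, r y, r (r y)}" by auto
    then show "?P (r a)" using sy by blast
  next
    fix a assume "?P a"
    then obtain s y where sy: "s \<in> \<Sigma>" "y \<in> Y s" "a \<in> {y, r y, r (r y)}" by blast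
    then show "?P (o' a)" by (rule opp)
  qed
  obtain c where c: "c \<in> ars" "card (L c) \<noteq> 6" using not_all_hexagons by blast
  obtain s y where sy: "s \<in> \<Sigma>" "y \<in> Y s" "c = y \<or> c = r y \<or> c = r (r y)" using P[OF c(1)] by blast
  then show False using hex[OF sy(1,2)] c(2) by auto
qed

text \<open>
  A lens consists of arcs \<open>a\<close>, \<open>b\<close> such that \<open>b\<close> is reached from \<open>a\<close> in \<open>k\<close> steps along a face and
  \<open>o' a\<close> from \<open>o' b\<close> in \<open>m\<close> steps along the face on the other side. The edges of \<open>a\<close> and \<open>b\<close> then cut
  off a region with \<open>k + m - 2\<close> boundary edges. Lenses with \<open>k + m < 6\<close> are impossible for local
  reasons; for \<open>k + m = 6\<close> there is a further lens of the same kind inside.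
\<close>

lemma no_lens_1:
  assumes "a \<in> ars" "g a = b" "(g ^^ k) (o' b) = o' a"
  shows False
proof -
  have "L (o' b) = L (o' a)" using face_at_funpow[of k "o' b"] assms(3) by simp
  moreover have "b = r (r (o' a))" using assms(2) by (simp add: face_succ_eq)
  then have "L (o' b) = L (r (o' a))" using face_at_opp_eq[of b] by simp
  ultimately show False using face_at_rot_neq[of "o' a"] assms(1) by simp
qed

text \<open>The inner boundary consists of the edges of \<open>x\<close> and \<open>z\<close>, which
  join the same two vertices. In a simple graph they coincide, and then \<open>r\<close> fixes the
  arc \<open>o' a\<close>.\<close>

lemma no_lens_2_2:
  assumes a: "a \<in> ars" and b: "g (g a) = b" and c: "g (g (o' b)) = o' a"
  shows False
proof -
  define x z where "x = g a" and "z = g (o' b)"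
  have ars: "x \<in> ars" "z \<in> ars" "b \<in> ars" using a b by (auto simp: x_def z_def)
  have "tail (skel F) z = tail (skel F) (o' x)"
    using ars b tail_face_succ[of "o' b"] tail_face_succ[of x]
    by (simp add: z_def x_def head_opp tail_opp)
  moreover have "head (skel F) z = head (skel F) (o' x)"
    using ars a b c tail_face_succ[of z] tail_face_succ[of a]
    by (simp add: z_def x_def head_opp tail_opp)
  ultimately have "z = o' x" using arc_eqI[of z "o' x"] ars by simp
  moreover have "g z = o' a" using c by (simp add: z_def)
  ultimately have "r (o' a) = o' a" by (simp add: face_succ_eq x_def)
  then show False using rot_neq[of "o' a"] a by simp
qed

text \<open>The inner boundary is a triangle, and \<open>e\<close> is the only edge that points into
  it. The face inside walks around the triangle and meets \<open>e\<close> from both sides.\<close>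

lemma no_lens_2_3:
  assumes a: "a \<in> ars" and b: "g (g a) = b" and c: "g (g (g (o' b))) = o' a"
  shows False
proof -
  define x z1 z2 e where "x = g a" and "z1 = g (o' b)" and "z2 = g z1" and "e = r (o' z1)"
  note d = x_def z1_def z2_def e_def face_succ_eq
  have "g z2 = o' a" using c by (simp add: z1_def z2_def)
  then have "o' z2 = r (o' a)" by (metis face_succ_eq rot_rot_rot)
  then have "g (o' x) = o' z2" by (simp add: x_def face_succ_eq)
  moreover have "g (o' z2) = e" by (simp add: d)
  moreover have "g (o' e) = o' z1" by (simp add: d)
  moreover have "g (o' z1) = o' x"
    using b by (simp add: z1_def face_succ_eq x_def flip: b)
  ultimately have "L (o' e) = L e" by (metis face_at_face_succ)
  moreover have "e \<in> ars" using a b by (auto simp: e_def z1_def)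
  ultimately show False using face_at_opp_neq by blast
qed

lemma no_lens_3_2:
  assumes a: "a \<in> ars" and b: "g (g (g a)) = b" and c: "g (g (o' b)) = o' a"
  shows False
  by (rule no_lens_2_3[of "o' b" "o' a"]) (use assms in auto)

section \<open>Lenses with six steps: the next lens inside and the closed family of nested
  rings\<close>

lemma card_face_at: "a \<in> ars \<Longrightarrow> card (L a) = 5 \<or> card (L a) = 6"
  by (simp add: card_face)

lemma funpow_card_face_at: "a \<in> ars \<Longrightarrow> (g ^^ card (L a)) a = a"
  by (rule face_funpow(1)) simp_all

lemma inj_invariant_surj:
  assumes "\<Sigma> \<subseteq> ars" "inj N" "\<And>s. s \<in> \<Sigma> \<Longrightarrow> N s \<in> \<Sigma>"
  shows "N ` \<Sigma> = \<Sigma>"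
  using assms finite_subset[OF assms(1) finite_arcs]
  by (intro endo_inj_surj) (auto intro: inj_on_subset)

lemma inj_rot: "inj r" and inj_opp: "inj o'" and inj_face_succ: "inj g"
  using permutes_inj rot_perm opp_perm face_succ_permutes by blast+

text \<open>Of the four vertices on the inner boundary, the one between \<open>x1\<close> and
  \<open>x2\<close> and the one between \<open>z1\<close> and \<open>z2\<close> send an edge inward,
  along \<open>e1\<close> and \<open>N\<close>. Both edges separate the same two faces and so bound
  a lens again. Lengths 5 and 6 leave two or three steps on either side, and only three and three
  has not been excluded.\<close>

lemma lens_step_3_3:
  assumes a: "a \<in> ars" and c: "g (g (g (o' (g (g (g a)))))) = o' a"
  defines "N \<equiv> r (o' (g (o' (g (g (g a))))))"
  shows "g (g (g N)) = o' (r (o' (g a)))" "g (g (g (o' (g (g (g N)))))) = o' N"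
    "card (L N) = 6" "card (L (o' N)) = 6"
proof -
  define x1 x2 b z1 z2 e1 where "x1 = g a" and "x2 = g x1" and "b = g x2" and "z1 = g (o' b)"
    and "z2 = g z1" and "e1 = r (o' x1)"
  note d = x1_def x2_def b_def z1_def z2_def e1_def
  have N: "N = r (o' z1)" by (simp add: N_def d)
  have ars: "x1 \<in> ars" "x2 \<in> ars" "b \<in> ars" "z1 \<in> ars" "z2 \<in> ars" "e1 \<in> ars" "N \<in> ars"
    using a by (simp_all add: d N)
  have "g z2 = o' a" using c by (simp add: d)
  then have oz2: "o' z2 = r (o' a)" by (metis face_succ_eq rot_rot_rot)
  have h: "g (o' e1) = o' x1" "g (o' x1) = o' z2" "g (o' z2) = N"
    by (simp add: e1_def face_succ_eq) (simp add: x1_def oz2[symmetric] face_succ_eq, simp add: z2_def N face_succ_eq)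
  have h': "g (o' N) = o' z1" "g (o' z1) = o' x2" "g (o' x2) = e1"
    by (simp_all add: N e1_def z1_def b_def x2_def face_succ_eq)
  have LN: "L N = L (o' e1)" and LoN: "L (o' N) = L e1"
    by (metis h face_at_face_succ) (metis h' face_at_face_succ)
  \<comment> \<open>Three steps lead from \<open>o' e1\<close> to \<open>N\<close>; the remaining
    two or three lead back.\<close>
  have 1: "g (g N) = o' e1 \<or> g (g (g N)) = o' e1 \<and> card (L N) = 6"
    using card_face_at[of "o' e1"] funpow_card_face_at[of "o' e1"] ars h LN
    by (auto simp: numeral_eq_Suc)
  have 2: "g (g e1) = o' N \<or> g (g (g e1)) = o' N \<and> card (L (o' N)) = 6"
    using card_face_at[of "o' N"] funpow_card_face_at[of "o' N"] ars h' LoN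
    by (auto simp: numeral_eq_Suc)
  have 3: "g (g (g N)) = o' e1 \<and> card (L N) = 6 \<and> g (g (g e1)) = o' N \<and> card (L (o' N)) = 6"
    using 1 2 no_lens_2_2[of N "o' e1"] no_lens_2_3[of N "o' e1"] no_lens_3_2[of N "o' e1"] ars by auto
  then show "g (g (g N)) = o' (r (o' (g a)))" "g (g (g (o' (g (g (g N)))))) = o' N"
    "card (L N) = 6" "card (L (o' N)) = 6"
    by (simp_all add: e1_def x1_def)
qed

text \<open>Three of the four inner boundary edges now lie on one face. On the left of
  \<open>N\<close> four steps of the new face are outer ones, on the right two, which leaves one or
  two and three or four steps; only two and four survives.\<close>

lemma lens_step_2_4:
  assumes a: "a \<in> ars" and c: "g (g (g (g (o' (g (g a)))))) = o' a"
  defines "N \<equiv> r (o' (g (g (o' (g (g a))))))"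
  shows "g (g N) = o' (r (o' (g (o' (g (g a))))))" "g (g (g (g (o' (g (g N)))))) = o' N"
    "card (L N) = 6" "card (L (o' N)) = 6"
proof -
  define x b z1 z2 z3 e1 where "x = g a" and "b = g x" and "z1 = g (o' b)"
    and "z2 = g z1" and "z3 = g z2" and "e1 = r (o' z1)"
  note d = x_def b_def z1_def z2_def z3_def e1_def
  have N: "N = r (o' z2)" by (simp add: N_def d)
  have ars: "x \<in> ars" "b \<in> ars" "z1 \<in> ars" "z2 \<in> ars" "z3 \<in> ars" "e1 \<in> ars" "N \<in> ars"
    using a by (simp_all add: d N)
  have "g z3 = o' a" using c by (simp add: d)
  then have oz3: "o' z3 = r (o' a)" by (metis face_succ_eq rot_rot_rot)
  have h: "g (o' e1) = o' z1" "g (o' z1) = o' x" "g (o' x) = o' z3" "g (o' z3) = N"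
       apply (simp add: e1_def face_succ_eq)
      apply (simp add: z1_def b_def face_succ_eq)
     apply (simp add: x_def oz3 face_succ_eq)
    apply (simp add: z3_def N face_succ_eq)
    done
  have h': "g (o' N) = o' z2" "g (o' z2) = e1"
    by (simp_all add: N e1_def z2_def face_succ_eq)
  have LN: "L N = L (o' e1)" and LoN: "L (o' N) = L e1"
    by (metis h face_at_face_succ) (metis h' face_at_face_succ)
  have 1: "g N = o' e1 \<or> g (g N) = o' e1 \<and> card (L N) = 6"
    using card_face_at[of "o' e1"] funpow_card_face_at[of "o' e1"] ars h LN
    by (auto simp: numeral_eq_Suc)
  have 2: "g (g (g e1)) = o' N \<or> g (g (g (g e1))) = o' N \<and> card (L (o' N)) = 6"
    using card_face_at[of "o' N"] funpow_card_face_at[of "o' N"] ars h' LoN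
    by (auto simp: numeral_eq_Suc)
  have 0: "g N \<noteq> o' e1"
  proof
    assume *: "g N = o' e1"
    show False
      using 2 no_lens_1[OF ars(7) *, of 3] no_lens_1[OF ars(7) *, of 4]
      by (elim disjE conjE) (simp_all add: numeral_eq_Suc)
  qed
  have 3: "g (g N) = o' e1 \<and> card (L N) = 6 \<and> g (g (g (g e1))) = o' N \<and> card (L (o' N)) = 6"
    using 0 1 2 no_lens_2_3[of N "o' e1"] ars by auto
  then show "g (g N) = o' (r (o' (g (o' (g (g a))))))" "g (g (g (g (o' (g (g N)))))) = o' N"
    "card (L N) = 6" "card (L (o' N)) = 6"
    by (simp_all add: e1_def z1_def b_def x_def)
qed

text \<open>\<open>N\<close> passes to the next lens inside. It is injective, so on the finite set
  \<open>\<Sigma>\<close> of such lenses between two hexagons it is onto, and each ring has a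
  neighbouring ring outside as well as inside. All edges at the rings then stay among the
  rings.\<close>

lemma no_lens_3_3:
  assumes a: "a \<in> ars" and c: "g (g (g (o' (g (g (g a)))))) = o' a"
  shows False
proof -
  define N where "N a = r (o' (g (o' (g (g (g a))))))" for a
  define \<Sigma> where "\<Sigma> = {a \<in> ars. g (g (g (o' (g (g (g a)))))) = o' a \<and>
    card (L a) = 6 \<and> card (L (o' a)) = 6}"
  \<comment> \<open>One arc at each of the four vertices of the inner boundary.\<close>
  define Y where "Y a = {o' a, o' (g a), g (g (g a)), o' (g (o' (g (g (g a)))))}" for a
  have N_ars: "N a \<in> ars" if "a \<in> ars" for a using that by (simp add: N_def)
  \<comment> \<open>The given lens need not lie between two hexagons, but the one inside it
    does.\<close>
  have start: "N a \<in> \<Sigma>"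
    using lens_step_3_3[OF a c] N_ars[OF a] by (simp add: \<Sigma>_def N_def)
  have step: "N s \<in> \<Sigma>" if "s \<in> \<Sigma>" for s
    using lens_step_3_3[of s] N_ars[of s] that by (simp add: \<Sigma>_def N_def)
  have "inj N"
    unfolding N_def by (intro injI) (metis inj_rot inj_opp inj_face_succ injD)
  then have surj: "N ` \<Sigma> = \<Sigma>"
    by (intro inj_invariant_surj step) (auto simp: \<Sigma>_def)
  show False
  proof (rule no_ring[of \<Sigma> Y])
    show "\<Sigma> \<noteq> {}" using start by blast
    show "y \<in> ars" if "s \<in> \<Sigma>" "y \<in> Y s" for s y
      using that by (auto simp: \<Sigma>_def Y_def)
    show "Y s \<noteq> {}" for s by (simp add: Y_def)
  next
    fix s y c
    assume s: "s \<in> \<Sigma>" and "y \<in> Y s" "c \<in> {y, r y, r (r y)}"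
    define W where "W c \<longleftrightarrow> (\<exists>s\<in>\<Sigma>. \<exists>y\<in>Y s. c \<in> {y, r y, r (r y)})" for c
    have W: "W y" "W (r y)" "W (r (r y))" if "s \<in> \<Sigma>" "y \<in> Y s" for s y
      using that by (auto simp: W_def)
    have Y: "o' a \<in> Y a" "o' (g a) \<in> Y a" "g (g (g a)) \<in> Y a" "o' (g (o' (g (g (g a))))) \<in> Y a" for a
      by (simp_all add: Y_def)
    \<comment> \<open>The edges of \<open>s\<close> and \<open>b\<close> lead outward; their other
      ends lie on the ring of the preceding lens \<open>t\<close>, which surjectivity
      provides.\<close>
    obtain t where t: "t \<in> \<Sigma>" "s = N t" using surj s by (metis imageE)
    define x1 x2 b z1 z2 where "x1 = g s" and "x2 = g x1" and "b = g x2" and "z1 = g (o' b)"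
      and "z2 = g z1"
    note d = x1_def x2_def b_def z1_def z2_def
    have Ys: "Y s = {o' s, o' x1, b, o' z1}" by (simp add: Y_def d)
    have Ns: "N s = r (o' z1)" "N s \<in> \<Sigma>" using step[OF s] by (simp_all add: N_def d)
    have bN: "g (g (g (N s))) = o' (r (o' x1))" and bs: "b = o' (r (o' (g t)))"
      using lens_step_3_3(1)[of s] lens_step_3_3(1)[of t] s t by (simp_all add: \<Sigma>_def N_def d)
    have "g z2 = o' s" using s by (simp add: \<Sigma>_def d)
    then have z2: "o' z2 = r (o' s)" by (simp add: face_succ_iff)
    have "W s" using W(2)[OF t(1) Y(4)] t(2) by (simp add: N_def)
    moreover have "W (o' (r (o' s)))"
      using W(3)[OF s Y(4)] by (simp add: z2[symmetric]) (simp add: d face_succ_eq)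
    moreover have "W (o' (r (r (o' s))))"
      using W(1)[OF s Y(2)] by (simp add: face_succ_eq)
    moreover have "W x1"
      using W(3)[OF s Y(1)] by (simp add: d face_succ_eq)
    moreover have "W (o' (r (o' x1)))"
      using W(1)[OF Ns(2) Y(3)] by (simp add: bN)
    moreover have "r b = o' x2" by (simp add: b_def face_succ_eq)
    then have "W (o' (r (r (o' x1))))"
      using W(2)[OF s Y(3)] by (simp add: d face_succ_eq)
    moreover have "W (o' b)"
      using W(2)[OF t(1) Y(2)] by (simp add: bs)
    moreover have "W (o' (r b))"
      using W(3)[OF s Y(2)] \<open>r b = o' x2\<close> by (simp add: d face_succ_eq)
    moreover have "W (o' (r (r b)))"
      using W(1)[OF s Y(4)] by (simp add: d face_succ_eq)
    moreover have "W z1"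
      using W(3)[OF s Y(3)] by (simp add: d face_succ_eq)
    moreover have "W (o' (r (o' z1)))"
      using W(1)[OF Ns(2) Y(1)] by (simp add: Ns)
    moreover have "W (o' (r (r (o' z1))))"
      using W(2)[OF s Y(1)] z2 by (simp add: d face_succ_eq)
    ultimately have "W (o' c)"
      using \<open>y \<in> Y s\<close> \<open>c \<in> {y, r y, r (r y)}\<close> unfolding Ys by auto
    then show "\<exists>s\<in>\<Sigma>. \<exists>y\<in>Y s. o' c \<in> {y, r y, r (r y)}" by (simp only: W_def)
  next
    fix s y
    assume s: "s \<in> \<Sigma>" and y: "y \<in> Y s"
    define x1 x2 b z1 z2 where "x1 = g s" and "x2 = g x1" and "b = g x2" and "z1 = g (o' b)"
      and "z2 = g z1"
    note d = x1_def x2_def b_def z1_def z2_def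
    have Ys: "y = o' s \<or> y = o' x1 \<or> y = b \<or> y = o' z1" using y by (auto simp: Y_def d)
    have Ns: "N s = r (o' z1)" "N s \<in> \<Sigma>" using step[OF s] by (simp_all add: N_def d)
    have "g z2 = o' s" using s by (simp add: \<Sigma>_def d)
    then have z2: "o' z2 = r (o' s)" by (simp add: face_succ_iff)
    \<comment> \<open>The faces around the four ring vertices are only those on the two sides of
      \<open>s\<close> and of \<open>N s\<close>, all of them hexagons.\<close>
    have f1: "L x1 = L s" "L x2 = L s" "L b = L s" by (simp_all add: d)
    have f2: "L z1 = L (o' s)" "L z2 = L (o' s)" "L (o' b) = L (o' s)"
      using \<open>g z2 = o' s\<close> by (metis face_at_face_succ z1_def z2_def)+
    have f3: "L (o' z2) = L (N s)" "L (o' x1) = L (N s)"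
    proof -
      have "g (o' z2) = N s" by (simp add: Ns z2_def face_succ_eq)
      then show 1: "L (o' z2) = L (N s)" by (metis face_at_face_succ)
      have "g (o' x1) = o' z2" by (simp add: x1_def z2 face_succ_eq)
      then show "L (o' x1) = L (N s)" using 1 by (metis face_at_face_succ)
    qed
    have f4: "L (o' z1) = L (o' (N s))" "L (o' x2) = L (o' (N s))" "L (r (o' x1)) = L (o' (N s))"
    proof -
      have "g (o' (N s)) = o' z1" by (simp add: Ns face_succ_eq)
      then show 1: "L (o' z1) = L (o' (N s))" by (metis face_at_face_succ)
      have "g (o' z1) = o' x2" by (simp add: z1_def b_def face_succ_eq)
      then show 2: "L (o' x2) = L (o' (N s))" using 1 by (metis face_at_face_succ)
      have "g (o' x2) = r (o' x1)" by (simp add: x2_def face_succ_eq)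
      then show "L (r (o' x1)) = L (o' (N s))" using 2 by (metis face_at_face_succ)
    qed
    have e: "r (o' z2) = x1" "r (r (o' x1)) = x2" "r b = o' x2" "r (o' x2) = z1"
      "r (o' z1) = N s" "r (N s) = z2" "r (o' s) = o' z2"
      using z2 by (simp_all add: d Ns face_succ_eq)
    have six: "card (L s) = 6" "card (L (o' s)) = 6" "card (L (N s)) = 6" "card (L (o' (N s))) = 6"
      using s Ns(2) by (simp_all add: \<Sigma>_def)
    from Ys show "card (L y) = 6 \<and> card (L (r y)) = 6 \<and> card (L (r (r y))) = 6"
      by (elim disjE) (simp_all only: e f1 f2 f3 f4 six simp_thms)
  qed
qed

text \<open>The same descent for the asymmetric shape, whose inner boundary has one edge on the
  first face and three on the second.\<close>

lemma no_lens_2_4: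
  assumes a: "a \<in> ars" and b0: "g (g a) = b0" and c0: "g (g (g (g (o' b0)))) = o' a"
  shows False
proof -
  define N where "N a = r (o' (g (g (o' (g (g a))))))" for a
  define \<Sigma> where "\<Sigma> = {a \<in> ars. g (g (g (g (o' (g (g a)))))) = o' a \<and>
    card (L a) = 6 \<and> card (L (o' a)) = 6}"
  define Y where "Y a = {o' a, g (g a), o' (g (o' (g (g a)))), o' (g (g (o' (g (g a)))))}" for a
  have c: "g (g (g (g (o' (g (g a)))))) = o' a" using b0 c0 by simp
  have N_ars: "N a \<in> ars" if "a \<in> ars" for a using that by (simp add: N_def)
  have start: "N a \<in> \<Sigma>"
    using lens_step_2_4[OF a c] N_ars[OF a] by (simp add: \<Sigma>_def N_def)
  have step: "N s \<in> \<Sigma>" if "s \<in> \<Sigma>" for s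
    using lens_step_2_4[of s] N_ars[of s] that by (simp add: \<Sigma>_def N_def)
  have "inj N"
    unfolding N_def by (intro injI) (metis inj_rot inj_opp inj_face_succ injD)
  then have surj: "N ` \<Sigma> = \<Sigma>"
    by (intro inj_invariant_surj step) (auto simp: \<Sigma>_def)
  show False
  proof (rule no_ring[of \<Sigma> Y])
    show "\<Sigma> \<noteq> {}" using start by blast
    show "y \<in> ars" if "s \<in> \<Sigma>" "y \<in> Y s" for s y
      using that by (auto simp: \<Sigma>_def Y_def)
    show "Y s \<noteq> {}" for s by (simp add: Y_def)
  next
    fix s y c
    assume s: "s \<in> \<Sigma>" and "y \<in> Y s" "c \<in> {y, r y, r (r y)}"
    define W where "W c \<longleftrightarrow> (\<exists>s\<in>\<Sigma>. \<exists>y\<in>Y s. c \<in> {y, r y, r (r y)})" for c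
    have W: "W y" "W (r y)" "W (r (r y))" if "s \<in> \<Sigma>" "y \<in> Y s" for s y
      using that by (auto simp: W_def)
    have Y: "o' a \<in> Y a" "g (g a) \<in> Y a" "o' (g (o' (g (g a)))) \<in> Y a"
      "o' (g (g (o' (g (g a))))) \<in> Y a" for a
      by (simp_all add: Y_def)
    obtain t where t: "t \<in> \<Sigma>" "s = N t" using surj s by (metis imageE)
    define x b z1 z2 z3 where "x = g s" and "b = g x" and "z1 = g (o' b)"
      and "z2 = g z1" and "z3 = g z2"
    note d = x_def b_def z1_def z2_def z3_def
    have Ys: "Y s = {o' s, b, o' z1, o' z2}" by (simp add: Y_def d)
    have Ns: "N s = r (o' z2)" "N s \<in> \<Sigma>" using step[OF s] by (simp_all add: N_def d)
    have bN: "g (g (N s)) = o' (r (o' z1))" and bs: "b = o' (r (o' (g (o' (g (g t))))))"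
      using lens_step_2_4(1)[of s] lens_step_2_4(1)[of t] s t by (simp_all add: \<Sigma>_def N_def d)
    have "g z3 = o' s" using s by (simp add: \<Sigma>_def d)
    then have z3: "o' z3 = r (o' s)" by (simp add: face_succ_iff)
    have rb: "r b = o' x" by (simp add: b_def face_succ_eq)
    have "W s" using W(2)[OF t(1) Y(4)] t(2) by (simp add: N_def)
    moreover have "W (o' (r (o' s)))"
      using W(3)[OF s Y(4)] by (simp add: z3[symmetric]) (simp add: d face_succ_eq)
    moreover have "W (o' (r (r (o' s))))"
      using W(2)[OF s Y(2)] by (simp add: face_succ_eq)
    moreover have "W (o' b)"
      using W(2)[OF t(1) Y(3)] by (simp add: bs)
    moreover have "W (o' (r b))"
      using W(3)[OF s Y(1)] rb by (simp add: d face_succ_eq)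
    moreover have "W (o' (r (r b)))"
      using W(1)[OF s Y(3)] by (simp add: d face_succ_eq)
    moreover have "W z1"
      using W(3)[OF s Y(2)] by (simp add: d face_succ_eq)
    moreover have "W (o' (r (o' z1)))"
      using W(1)[OF Ns(2) Y(2)] by (simp add: bN)
    moreover have "W (o' (r (r (o' z1))))"
      using W(1)[OF s Y(4)] by (simp add: d face_succ_eq)
    moreover have "W z2"
      using W(3)[OF s Y(3)] by (simp add: d face_succ_eq)
    moreover have "W (o' (r (o' z2)))"
      using W(1)[OF Ns(2) Y(1)] by (simp add: Ns)
    moreover have "W (o' (r (r (o' z2))))"
      using W(2)[OF s Y(1)] z3 by (simp add: d face_succ_eq)
    ultimately have "W (o' c)"
      using \<open>y \<in> Y s\<close> \<open>c \<in> {y, r y, r (r y)}\<close> unfolding Ys by auto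
    then show "\<exists>s\<in>\<Sigma>. \<exists>y\<in>Y s. o' c \<in> {y, r y, r (r y)}" by (simp only: W_def)
  next
    fix s y
    assume s: "s \<in> \<Sigma>" and y: "y \<in> Y s"
    define x b z1 z2 z3 where "x = g s" and "b = g x" and "z1 = g (o' b)"
      and "z2 = g z1" and "z3 = g z2"
    note d = x_def b_def z1_def z2_def z3_def
    have Ys: "y = o' s \<or> y = b \<or> y = o' z1 \<or> y = o' z2" using y by (auto simp: Y_def d)
    have Ns: "N s = r (o' z2)" "N s \<in> \<Sigma>" using step[OF s] by (simp_all add: N_def d)
    have gz3: "g z3 = o' s" using s by (simp add: \<Sigma>_def d)
    then have z3: "o' z3 = r (o' s)" by (simp add: face_succ_iff)
    have f1: "L x = L s" "L b = L s" by (simp_all add: d)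
    have f2: "L z1 = L (o' s)" "L z2 = L (o' s)" "L z3 = L (o' s)"
      using gz3 by (metis face_at_face_succ z2_def z3_def)+
    have f3: "L (o' z3) = L (N s)" "L (o' x) = L (N s)" "L (o' z1) = L (N s)"
    proof -
      have "g (o' z3) = N s" by (simp add: Ns z3_def face_succ_eq)
      then show 1: "L (o' z3) = L (N s)" by (metis face_at_face_succ)
      have "g (o' x) = o' z3" by (simp add: x_def z3 face_succ_eq)
      then show 2: "L (o' x) = L (N s)" using 1 by (metis face_at_face_succ)
      have "g (o' z1) = o' x" by (simp add: z1_def b_def face_succ_eq)
      then show "L (o' z1) = L (N s)" using 2 by (metis face_at_face_succ)
    qed
    have f4: "L (o' z2) = L (o' (N s))" "L (r (o' z1)) = L (o' (N s))"
    proof -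
      have "g (o' (N s)) = o' z2" by (simp add: Ns face_succ_eq)
      then show 1: "L (o' z2) = L (o' (N s))" by (metis face_at_face_succ)
      have "g (o' z2) = r (o' z1)" by (simp add: z2_def face_succ_eq)
      then show "L (r (o' z1)) = L (o' (N s))" using 1 by (metis face_at_face_succ)
    qed
    have e: "r (o' s) = o' z3" "r (o' z3) = x" "r b = o' x" "r (o' x) = z1"
      "r (r (o' z1)) = z2" "r (o' z2) = N s" "r (N s) = z3"
      using z3 by (simp_all add: d Ns face_succ_eq)
    have six: "card (L s) = 6" "card (L (o' s)) = 6" "card (L (N s)) = 6" "card (L (o' (N s))) = 6"
      using s Ns(2) by (simp_all add: \<Sigma>_def)
    from Ys show "card (L y) = 6 \<and> card (L (r y)) = 6 \<and> card (L (r (r y))) = 6"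
      by (elim disjE) (simp_all only: e f1 f2 f3 f4 six simp_thms)
  qed
qed

text \<open>Seen from the other face, a lens with steps \<open>k\<close>, \<open>m\<close> at
  \<open>a\<close>, \<open>b\<close> is one with steps \<open>m\<close>, \<open>k\<close> at
  \<open>o' b\<close>, \<open>o' a\<close>; this symmetry supplies the mirrored cases.\<close>

lemma no_short_lens:
  assumes a: "a \<in> ars" and b: "(g ^^ k) a = b" and c: "(g ^^ m) (o' b) = o' a"
    and "0 < k" "0 < m" "k + m \<le> 6"
  shows False
proof -
  have ob: "o' b \<in> ars" using a b by (induct k arbitrary: b) auto
  consider "k = 1" | "m = 1" | "k = 2" "m = 2" | "k = 2" "m = 3" | "k = 3" "m = 2"
    | "k = 2" "m = 4" | "k = 4" "m = 2" | "k = 3" "m = 3"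
    using assms(4-6) by linarith
  then show False
  proof cases
    case 1
    then show ?thesis using no_lens_1[OF a _ c] b by simp
  next
    case 2
    then show ?thesis using no_lens_1[OF ob, of "o' a" k] b c by simp
  next
    case 3
    then show ?thesis using no_lens_2_2[OF a] b c by (simp add: numeral_eq_Suc)
  next
    case 4
    then show ?thesis using no_lens_2_3[OF a] b c by (simp add: numeral_eq_Suc)
  next
    case 5
    then show ?thesis using no_lens_3_2[OF a] b c by (simp add: numeral_eq_Suc)
  next
    case 6
    then show ?thesis using no_lens_2_4[OF a] b c by (simp add: numeral_eq_Suc)
  next
    case 7
    then show ?thesis using no_lens_2_4[OF ob, of "o' a"] b c by (simp add: numeral_eq_Suc)
  next
    case 8
    then show ?thesis using no_lens_3_3[OF a] b c by (simp add: numeral_eq_Suc)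
  qed
qed

text \<open>Two common edges would bound a lens on either side. The steps of both lenses add up to
  the lengths of the two faces, at most 12, so one of the lenses has at most 6.\<close>

theorem faces_share_at_most_one_edge:
  assumes a: "a \<in> ars" and b: "b \<in> ars" and left: "L a = L b" and right: "L (o' a) = L (o' b)"
  shows "a = b"
proof (rule ccontr)
  assume "a \<noteq> b"
  obtain k where k: "k < card (L a)" "(g ^^ k) a = b"
    using face_funpow(3)[of "L a" a b] a left by (metis face_at_in_faces self_in_face_at)
  obtain m where m: "m < card (L (o' b))" "(g ^^ m) (o' b) = o' a"
    using face_funpow(3)[of "L (o' b)" "o' b" "o' a"] a b right
    by (metis face_at_in_faces self_in_face_at opp_in_iff)
  have pos: "0 < k" "0 < m"
    using k m \<open>a \<noteq> b\<close> by (auto intro!: Nat.gr0I) (metis opp_opp')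
  have "(g ^^ (card (L a) - k)) ((g ^^ k) a) = a"
    using k(1) funpow_card_face_at[OF a] by (simp flip: funpow_add[THEN fun_cong, simplified])
  then have k': "(g ^^ (card (L a) - k)) b = a" by (simp add: k)
  have "(g ^^ (card (L (o' b)) - m)) ((g ^^ m) (o' b)) = o' b"
    using m(1) funpow_card_face_at[of "o' b"] b by (simp flip: funpow_add[THEN fun_cong, simplified])
  then have m': "(g ^^ (card (L (o' b)) - m)) (o' a) = o' b" by (simp add: m)
  show False
  proof (cases "k + m \<le> 6")
    case True
    then show ?thesis using no_short_lens[OF a k(2) m(2) pos] by simp
  next
    case False
    then have "card (L a) - k + (card (L (o' b)) - m) \<le> 6"
      using card_face_at[OF a] card_face_at[of "o' b"] b by auto
    then show ?thesis using no_short_lens[OF b k' m'] k(1) m(1) by simp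
  qed
qed

end

section \<open>The parent of a leapfrog graph\<close>

text \<open>A leapfrog graph has a face of length 2d for each vertex of degree d of its parent and a
  copy of each face of the parent. \<open>S\<close> collects the copies, which meet every vertex
  exactly once.\<close>

locale leapfrog = trivalent_map X for X :: "('v, 'a) embedded_graph" +
  fixes S :: "'a set set"
  assumes S_subset: "S \<subseteq> faces X"
    and rot_notin_S: "\<And>a. a \<in> arcs (skel X) \<Longrightarrow> face_at X a \<in> S \<Longrightarrow> face_at X (rot X a) \<notin> S"
    and some_in_S: "\<And>a. a \<in> arcs (skel X) \<Longrightarrow>
      face_at X a \<in> S \<or> face_at X (rot X a) \<in> S \<or> face_at X (rot X (rot X a)) \<in> S"
begin

abbreviation "K \<equiv> dual_arcs X S"
abbreviation "P \<equiv> parent X S"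

text \<open>The faces at the tail of \<open>a\<close> are its left face, its right face and the one
  opposite to \<open>a\<close>, that of \<open>rot X a\<close>. Exactly one of them is in
  \<open>S\<close>, so \<open>a\<close> is crossed precisely when it is the opposite one.\<close>

lemma K_iff: "a \<in> K \<longleftrightarrow> a \<in> ars \<and> face_at X (rot X a) \<in> S"
proof (cases "a \<in> ars")
  case True
  then have "face_at X (rot X a) \<in> S \<longleftrightarrow> face_at X a \<notin> S \<and> face_at X (rot X (rot X a)) \<notin> S"
    using rot_notin_S[of a] rot_notin_S[of "rot X a"] rot_notin_S[of "rot X (rot X a)"] some_in_S[of a]
    by auto
  then show ?thesis using True by (simp add: dual_arcs_def face_at_opp_eq)
qed (simp add: dual_arcs_def)

lemma K_ars: "a \<in> K \<Longrightarrow> a \<in> ars"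
  by (simp add: dual_arcs_def)

lemma opp_K [simp]: "opp X a \<in> K \<longleftrightarrow> a \<in> K"
  by (auto simp: dual_arcs_def)

lemma finite_K: "finite K"
  using finite_arcs by (simp add: dual_arcs_def)

lemma rot_face_succ [simp]: "rot X (face_succ X a) = opp X a"
  by (simp add: face_succ_eq)

text \<open>At the head of a crossed arc, the face of \<open>S\<close> lies to the right of the next
  arc. This starts the alternation along the faces outside \<open>S\<close>.\<close>

lemma face_succ_notin_K: "a \<in> K \<Longrightarrow> face_succ X a \<notin> K"
  by (simp add: K_iff[of "face_succ X a"]) (simp add: dual_arcs_def)

lemma face_succ2_K: "a \<in> K \<Longrightarrow> face_succ X (face_succ X a) \<in> K"
  using K_iff[of "opp X a"] by (simp add: K_iff[of "face_succ X _"] K_ars face_at_opp_eq)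

lemma face_succ_in_K:
  assumes "a \<in> ars" "face_at X a \<notin> S" "a \<notin> K"
  shows "face_succ X a \<in> K"
  using assms some_in_S[of a] by (simp add: K_iff face_at_opp_eq)

lemma first_return_K:
  assumes "a \<in> K"
  shows "first_return (face_succ X) K a = face_succ X (face_succ X a)"
proof -
  have "(LEAST k. 0 < k \<and> (face_succ X ^^ k) a \<in> K) = 2"
  proof (rule Least_equality)
    show "0 < (2::nat) \<and> (face_succ X ^^ 2) a \<in> K"
      using face_succ2_K[OF assms] by (simp add: numeral_eq_Suc)
  next
    fix k assume k: "0 < k \<and> (face_succ X ^^ k) a \<in> K"
    then have "k \<noteq> 1" using face_succ_notin_K[OF assms] by auto
    then show "2 \<le> k" using k by linarith
  qed
  then show ?thesis by (simp add: first_return_def numeral_eq_Suc)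
qed

lemma verts_P: "verts (skel P) = faces X - S"
  and arcs_P: "arcs (skel P) = K"
  and tail_P: "tail (skel P) = face_at X"
  and head_P: "head (skel P) = (\<lambda>a. face_at X (opp X a))"
  by (simp_all add: parent_def)

lemma opp_P: "a \<in> K \<Longrightarrow> opp P a = opp X a"
  by (simp add: parent_def)

lemma rot_P: "a \<in> K \<Longrightarrow> rot P a = face_succ X (face_succ X a)"
  by (simp add: parent_def first_return_K)

lemma rot_P_permutes: "rot P permutes K"
proof (rule bij_imp_permutes)
  have inj: "inj_on (rot P) K" by (auto simp: inj_on_def rot_P)
  have "rot P ` K \<subseteq> K" using face_succ2_K by (auto simp: rot_P)
  then show "bij_betw (rot P) K K"
    using inj endo_inj_surj[OF finite_K] by (auto simp: bij_betw_def)
  show "rot P a = a" if "a \<notin> K" for a using that by (simp add: parent_def)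
qed

text \<open>
  The bijection from the arcs of the faces in \<open>S\<close> to the arcs of the parent that turns the face
  permutation of \<open>X\<close> into that of the parent.
\<close>

definition dual_arc :: "'a \<Rightarrow> 'a" where
  "dual_arc c = opp X (rot X (rot X c))"

lemma in_Union_S_iff: "c \<in> \<Union> S \<longleftrightarrow> c \<in> ars \<and> face_at X c \<in> S"
  using S_subset face_subset in_face_iff
  by (metis (no_types, lifting) UnionE UnionI self_in_face_at subsetD)

lemma dual_arc_K: "c \<in> \<Union> S \<Longrightarrow> dual_arc c \<in> K"
  using opp_K[of "rot X (rot X c)"] K_iff[of "rot X (rot X c)"]
  by (simp add: dual_arc_def in_Union_S_iff del: Union_iff opp_K)

lemma inj_dual_arc: "inj dual_arc"
proof (rule injI)
  fix c d assume "dual_arc c = dual_arc d"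
  then have "opp X (opp X (rot X (rot X c))) = opp X (opp X (rot X (rot X d)))"
    unfolding dual_arc_def by simp
  then have "rot X (rot X (rot X c)) = rot X (rot X (rot X d))" unfolding opp_opp' by simp
  then show "c = d" by simp
qed

lemma bij_betw_dual_arc: "bij_betw dual_arc (\<Union> S) K"
proof -
  have "a \<in> dual_arc ` \<Union> S" if "a \<in> K" for a
  proof (rule image_eqI)
    show "a = dual_arc (rot X (opp X a))" by (simp add: dual_arc_def)
    show "rot X (opp X a) \<in> \<Union> S"
      using that opp_K[of a] K_iff[of "opp X a"] by (simp add: in_Union_S_iff del: Union_iff opp_K)
  qed
  then show ?thesis
    using dual_arc_K inj_dual_arc by (auto simp: bij_betw_def intro: inj_on_subset)
qed

lemma face_at_dual_arc: "face_at X (dual_arc c) = face_at X (rot X c)"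
  by (simp add: dual_arc_def face_at_opp_eq)

lemma face_succ_P:
  assumes "c \<in> \<Union> S"
  shows "face_succ P (dual_arc c) = dual_arc (face_succ X c)"
proof -
  have c': "face_succ X c \<in> \<Union> S"
    using assms by (simp add: in_Union_S_iff del: Union_iff)
  have "rot P (dual_arc (face_succ X c)) = opp P (dual_arc c)"
    using dual_arc_K[OF assms] dual_arc_K[OF c'] by (simp add: rot_P opp_P dual_arc_def face_succ_eq)
  then show ?thesis
    unfolding face_succ_def[of P] by (metis permutes_inverses(2)[OF rot_P_permutes])
qed

lemma face_at_P:
  assumes "c \<in> \<Union> S"
  shows "face_at P (dual_arc c) = dual_arc ` face_at X c"
proof -
  have "dual_arc ` orbit (face_succ X) c = orbit (face_succ P) (dual_arc c)"
  proof (rule orbit_inverse)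
    show "c \<in> orbit (face_succ X) c" using self_in_face_at by (simp add: face_at_def)
  next
    fix x assume "x \<in> orbit (face_succ X) c"
    then have "x \<in> \<Union> S"
      using assms by (metis face_at_def in_Union_S_iff in_face_at_iff face_at_subset subsetD)
    then show "face_succ P (dual_arc x) = dual_arc (face_succ X x)" by (rule face_succ_P)
  qed
  then show ?thesis by (simp add: face_at_def)
qed

lemma faces_P: "faces P = (`) dual_arc ` S"
proof -
  have "faces P = face_at P ` dual_arc ` \<Union> S"
    using bij_betw_imp_surj_on[OF bij_betw_dual_arc] by (simp add: faces_def arcs_P)
  also have "\<dots> = (\<lambda>c. dual_arc ` face_at X c) ` \<Union> S"
    using face_at_P by (simp add: image_image)
  also have "\<dots> = (`) dual_arc ` face_at X ` \<Union> S"
    by (simp add: image_image)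
  also have "face_at X ` \<Union> S = S"
  proof (intro equalityI subsetI)
    fix f assume f: "f \<in> S"
    then obtain a where "a \<in> f" "f \<in> faces X" using S_subset face_nonempty by blast
    then show "f \<in> face_at X ` \<Union> S" using f face_eqI by (intro image_eqI[of _ _ a]) auto
  next
    fix f assume "f \<in> face_at X ` \<Union> S"
    then obtain c where "c \<in> \<Union> S" "f = face_at X c" by (rule imageE)
    then show "f \<in> S" by (simp only: in_Union_S_iff)
  qed
  finally show ?thesis .
qed

lemma finite_S: "finite S"
  using S_subset finite_faces finite_subset by blast

lemma inj_on_image_dual_arc: "inj_on ((`) dual_arc) S"
  by (rule inj_onI) (simp add: inj_image_eq_iff[OF inj_dual_arc])

lemma card_faces_P: "card (faces P) = card S"
  unfolding faces_P by (rule card_image[OF inj_on_image_dual_arc])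

lemma card_K: "card K = card (\<Union> S)"
  using bij_betw_same_card[OF bij_betw_dual_arc] by simp

text \<open>The arc before \<open>c\<close> on \<open>s\<close> is \<open>opp X (rot X c)\<close>,
  so the face of \<open>rot X c\<close> is the neighbour of \<open>s\<close> across that
  edge.\<close>

lemma face_verts_P: "face_verts P (dual_arc ` s) = (\<lambda>c. face_at X (rot X c)) ` s"
  by (simp add: face_verts_def tail_P image_image face_at_dual_arc)

lemma polygon_P:
  assumes "s \<in> S" "inj_on (\<lambda>c. face_at X (rot X c)) s"
  shows "polygon P (card s) (dual_arc ` s)"
  using assms inj_dual_arc
  by (auto simp: polygon_def faces_P face_verts_P card_image inj_on_subset)

section \<open>Degrees, rotation and planarity of the parent\<close>

lemma face_minus_K_image:
  assumes f: "f \<in> faces X - S"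
  shows "face_succ X ` (f \<inter> K) \<subseteq> f - K" "face_succ X ` (f - K) \<subseteq> f \<inter> K"
proof -
  show "face_succ X ` (f \<inter> K) \<subseteq> f - K"
    using f face_succ_notin_K by auto
  show "face_succ X ` (f - K) \<subseteq> f \<inter> K"
  proof
    fix y assume "y \<in> face_succ X ` (f - K)"
    then obtain a where a: "a \<in> f" "a \<notin> K" "y = face_succ X a" by auto
    moreover have "a \<in> ars" using a f face_subset by blast
    moreover have "face_at X a \<notin> S" using a f face_eqI by auto
    ultimately show "y \<in> f \<inter> K" using f face_succ_in_K by auto
  qed
qed

lemma out_arcs_P: "f \<in> faces X \<Longrightarrow> out_arcs (skel P) f = f \<inter> K"
  using K_ars by (auto simp: out_arcs_def arcs_P tail_P in_face_iff)

text \<open>\<open>face_succ X\<close> maps \<open>f \<inter> K\<close> and \<open>f - K\<close>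
  injectively into each other, so exactly half of the boundary is crossed.\<close>

lemma degree_P:
  assumes f: "f \<in> faces X - S"
  shows "2 * degree P f = card f"
proof -
  have fin: "finite f" using f finite_face by blast
  have inj: "inj_on (face_succ X) A" for A by (simp add: inj_on_def)
  have "card (f \<inter> K) = card (f - K)"
    using card_inj_on_le[OF inj face_minus_K_image(1)[OF f]]
      card_inj_on_le[OF inj face_minus_K_image(2)[OF f]] fin by auto
  moreover have "card f = card (f \<inter> K) + card (f - K)"
    using fin by (metis card_Int_Diff)
  ultimately show ?thesis using f by (simp add: degree_def out_degree_def out_arcs_P)
qed

lemma funpow_K:
  assumes "a \<in> K"
  shows "(rot P ^^ j) a \<in> K \<and> (face_succ X ^^ (2 * j)) a = (rot P ^^ j) a"
  using assms face_succ2_K by (induct j) (auto simp: rot_P)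

text \<open>Crossed arcs alternate with the others, so one crossed arc of \<open>f\<close> reaches
  another in an even number of steps, that is, by a power of \<open>rot P\<close>.\<close>

lemma cyclic_on_rot_P:
  assumes f: "f \<in> faces X" and ne: "f \<inter> K \<noteq> {}"
  shows "cyclic_on (rot P) (f \<inter> K)"
proof -
  obtain a where a: "a \<in> f" "a \<in> K" using ne by blast
  have "f \<inter> K = orbit (rot P) a"
  proof (intro equalityI subsetI)
    fix b assume b: "b \<in> f \<inter> K"
    then have "b \<in> orbit (face_succ X) a"
      using a f face_eqI by (metis IntD1 face_at_def)
    then obtain n where n: "b = (face_succ X ^^ n) a" "0 < n" by (auto simp: orbit_altdef)
    have "even n"
    proof (rule ccontr)
      assume "odd n"
      then obtain j where "n = Suc (2 * j)" by (metis oddE Suc_eq_plus1)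
      then show False using b n funpow_K[OF a(2), of j] face_succ_notin_K[of "(rot P ^^ j) a"] by simp
    qed
    then obtain j where "n = 2 * j" by (rule evenE)
    then show "b \<in> orbit (rot P) a"
      using n funpow_K[OF a(2), of j] by (auto simp: orbit_altdef intro!: exI[of _ j])
  next
    fix b assume "b \<in> orbit (rot P) a"
    then show "b \<in> f \<inter> K"
      by induct (use a f face_succ2_K in \<open>auto simp: rot_P\<close>)
  qed
  then show ?thesis using a by (auto simp: cyclic_on_def)
qed

lemma simple_rotation_system_P:
  assumes loopfree: "\<And>a. a \<in> K \<Longrightarrow> face_at X (opp X a) \<noteq> face_at X a"
    and nomulti: "\<And>a b. a \<in> K \<Longrightarrow> b \<in> K \<Longrightarrow> face_at X a = face_at X b \<Longrightarrow>
      face_at X (opp X a) = face_at X (opp X b) \<Longrightarrow> a = b"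
  shows "simple_rotation_system P"
proof
  have opp_ars: "face_at X (opp X a) \<in> faces X - S" "face_at X a \<in> faces X - S" if "a \<in> K" for a
    using that by (simp_all add: dual_arcs_def)
  show "tail (skel P) e \<in> verts (skel P)" "head (skel P) e \<in> verts (skel P)"
    if "e \<in> arcs (skel P)" for e
    using that opp_ars[of e] by (simp_all only: arcs_P tail_P head_P verts_P)
  show "finite (verts (skel P))" "finite (arcs (skel P))"
    using finite_faces finite_K by (simp_all add: verts_P arcs_P)
  show "tail (skel P) e \<noteq> head (skel P) e" if "e \<in> arcs (skel P)" for e
    using that loopfree[of e] by (simp add: arcs_P tail_P head_P)
  show "e1 = e2" if "e1 \<in> arcs (skel P)" "e2 \<in> arcs (skel P)"
    "arc_to_ends (skel P) e1 = arc_to_ends (skel P) e2" for e1 e2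
    using that nomulti[of e1 e2] by (simp add: arcs_P tail_P head_P arc_to_ends_def)
  show "symmetric (skel P)"
    unfolding symmetric_conv arcs_P tail_P head_P by (metis opp_K opp_opp')
  show "a \<in> arcs (skel P) \<longleftrightarrow> opp P a \<noteq> a" for a
    using opp_neq[of a] K_ars[of a] by (simp add: parent_def)
  show "opp P (opp P a) = a" if "a \<in> arcs (skel P)" for a
    using that by (simp add: arcs_P opp_P)
  show "tail (skel P) (opp P a) = head (skel P) a" if "a \<in> arcs (skel P)" for a
    using that by (simp add: arcs_P opp_P tail_P head_P)
  show "rot P permutes arcs (skel P)" using rot_P_permutes by (simp add: arcs_P)
qed

text \<open>The premise \<open>euler\<close> is twice Euler's formula, because the arcs of the
  parent are in bijection with \<open>\<Union> S\<close>.\<close>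

lemma connected_plane_graph_P:
  assumes simple: "simple_rotation_system P"
    and ne: "faces X - S \<noteq> {}"
    and conn: "\<And>f f'. f \<in> faces X - S \<Longrightarrow> f' \<in> faces X - S \<Longrightarrow> f \<rightarrow>\<^sup>*\<^bsub>skel P\<^esub> f'"
    and euler: "2 * int (card (faces X - S)) - int (card (\<Union> S)) + 2 * int (card S) = 4"
  shows "connected_plane_graph P"
proof -
  interpret P: simple_rotation_system P by (rule simple)
  interpret G: graph "skel P" by (rule P.simple_graph)
  show ?thesis
  proof (intro connected_plane_graph.intro P.simple_graph P.opposite P.rot_permutes)
    show "Digraph_Component.connected (skel P)"
      unfolding connected_def using ne conn
      by (auto simp: strongly_connected_def verts_P intro: G.reachable_mk_symmetricI)
    show "cyclic_on (rot P) (out_arcs (skel P) v)"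
      if "v \<in> verts (skel P)" "out_arcs (skel P) v \<noteq> {}" for v
      using that cyclic_on_rot_P[of v] by (simp add: verts_P out_arcs_P)
    have "2 * int (card (edges P)) = int (card (\<Union> S))"
      using P.card_ars card_K by (simp add: arcs_P)
    then show "int (card (verts (skel P))) - int (card (edges P)) + int (card (faces P)) = 2"
      using euler by (simp add: verts_P card_faces_P)
  qed
qed

end

section \<open>The expansion of a Clar structure\<close>

text \<open>Alternation enters through \<open>H_hexagon\<close>: an alternating face has an even
  number of edges.\<close>

locale clar_map = fullerene_map F for F :: "('v, 'a) embedded_graph" +
  fixes H :: "'a set set" and M :: "'v set set"
  assumes H_faces: "H \<subseteq> faces F"
    and H_disjoint: "\<And>f h. f \<in> H \<Longrightarrow> h \<in> H \<Longrightarrow> f \<noteq> h \<Longrightarrow> face_verts F f \<inter> face_verts F h = {}"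
    and H_hexagon: "\<And>f. f \<in> H \<Longrightarrow> card f = 6"
    and matching: "perfect_matching_on F (verts (skel F) - \<Union> (face_verts F ` H)) M"
begin

abbreviation "D \<equiv> arcs_of F M"
abbreviation "W \<equiv> verts (skel F) - \<Union> (face_verts F ` H)"
abbreviation "E \<equiv> expansion F M"
abbreviation "S \<equiv> kept_faces H \<union> new_quads F M"

lemma M_unique: "e \<in> M \<Longrightarrow> e' \<in> M \<Longrightarrow> v \<in> W \<Longrightarrow> v \<in> e \<Longrightarrow> v \<in> e' \<Longrightarrow> e = e'"
  using matching unfolding perfect_matching_on_def by metis

lemma M_subset: "e \<in> M \<Longrightarrow> e \<subseteq> W"
  using matching unfolding perfect_matching_on_def by metis

lemma M_edges: "e \<in> M \<Longrightarrow> e \<in> edges F"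
  using matching unfolding perfect_matching_on_def by blast

lemma M_covers: "v \<in> W \<Longrightarrow> \<exists>e\<in>M. v \<in> e"
  using matching unfolding perfect_matching_on_def by metis

lemma D_ars: "d \<in> D \<Longrightarrow> d \<in> ars"
  by (simp add: arcs_of_def)

lemma opp_D [simp]: "o' d \<in> D \<longleftrightarrow> d \<in> D"
  by (auto simp: arcs_of_def edge_of_opp)

lemma tail_D: "d \<in> D \<Longrightarrow> tail (skel F) d \<in> W"
  using M_subset[of "edge_of F d"] unfolding arcs_of_def edge_of_def by blast

lemma inj_on_tail_D:
  assumes "d \<in> D" "d' \<in> D" "tail (skel F) d = tail (skel F) d'"
  shows "d = d'"
proof -
  have "edge_of F d \<in> M" "edge_of F d' \<in> M" using assms by (simp_all add: arcs_of_def)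
  moreover have "tail (skel F) d \<in> edge_of F d" "tail (skel F) d \<in> edge_of F d'"
    using assms by (simp_all add: edge_of_def)
  ultimately have "edge_of F d = edge_of F d'" using M_unique tail_D[OF assms(1)] by blast
  then have "d = d' \<or> d = o' d'" using edge_of_eq_iff D_ars assms by blast
  moreover have "d \<noteq> o' d'"
    using assms(3) tail_neq_head[OF D_ars[OF assms(2)]] tail_opp[OF D_ars[OF assms(2)]] by auto
  ultimately show ?thesis by blast
qed

lemma rot_notin_D: "d \<in> D \<Longrightarrow> r d \<notin> D"
  using inj_on_tail_D[of "r d" d] tail_rot[of d] rot_neq[of d] D_ars[of d] by metis

lemma rot_rot_notin_D: "d \<in> D \<Longrightarrow> r (r d) \<notin> D"
  using rot_notin_D[of "r (r d)"] by auto

lemma face_at_notin_H: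
  assumes "tail (skel F) a \<in> W" "a \<in> ars"
  shows "L a \<notin> H"
proof
  assume "L a \<in> H"
  moreover have "tail (skel F) a \<in> face_verts F (L a)"
    using self_in_face_at[of a] unfolding face_verts_def by (rule imageI)
  ultimately show False using assms(1) by blast
qed

lemma D_notin_H: "d \<in> D \<Longrightarrow> L d \<notin> H" "d \<in> D \<Longrightarrow> L (r d) \<notin> H" "d \<in> D \<Longrightarrow> L (r (r d)) \<notin> H"
  using face_at_notin_H[of d] face_at_notin_H[of "r d"] face_at_notin_H[of "r (r d)"]
    tail_D[of d] D_ars[of d] by (simp_all add: tail_rot)

lemma rot_notin_H:
  assumes "a \<in> ars" "L a \<in> H"
  shows "L (r a) \<notin> H"
proof
  assume *: "L (r a) \<in> H"
  have "tail (skel F) a \<in> face_verts F (L a)" "tail (skel F) a \<in> face_verts F (L (r a))"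
    using self_in_face_at[of a] self_in_face_at[of "r a"] tail_rot[OF assms(1)]
    unfolding face_verts_def by (metis imageI)+
  then show False using H_disjoint[OF assms(2) *] face_at_rot_neq[OF assms(1)] by auto
qed

lemma same_tail_cases:
  assumes "a \<in> ars" "b \<in> ars" "tail (skel F) b = tail (skel F) a"
  shows "b = a \<or> b = r a \<or> b = r (r a)"
proof -
  have "b \<in> orbit r a"
    using assms(2,3) unfolding out_arcs_eq_orbit[OF assms(1), symmetric] by simp
  then show ?thesis by induct auto
qed

text \<open>A vertex outside the faces of \<open>H\<close> is covered by \<open>M\<close>. In the
  expansion this puts every vertex on a kept face or on a new quadrilateral.\<close>

lemma D_or_H:
  assumes a: "a \<in> ars"
  shows "a \<in> D \<or> r a \<in> D \<or> r (r a) \<in> D \<or> L a \<in> H \<or> L (r a) \<in> H \<or> L (r (r a)) \<in> H"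
proof (cases "tail (skel F) a \<in> W")
  case True
  then obtain e where e: "e \<in> M" "tail (skel F) a \<in> e" using M_covers by blast
  then obtain b where b: "b \<in> ars" "e = edge_of F b" using M_edges by (auto simp: edges_def)
  then have bD: "b \<in> D" using e by (simp add: arcs_of_def)
  have "tail (skel F) b = tail (skel F) a \<or> tail (skel F) (o' b) = tail (skel F) a"
    using e(2) b by (auto simp: edge_of_def tail_opp)
  then obtain c where "c \<in> D" "tail (skel F) c = tail (skel F) a" using bD opp_D by metis
  then show ?thesis using same_tail_cases[OF a, of c] D_ars by auto
next
  case False
  then obtain h where h: "h \<in> H" "tail (skel F) a \<in> face_verts F h" using tail_in_verts[OF a] by blast
  then obtain c where c: "c \<in> h" "tail (skel F) c = tail (skel F) a" by (auto simp: face_verts_def)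
  have "c \<in> ars" "L c = h" using c h H_faces face_subset face_eqI by blast+
  then show ?thesis using same_tail_cases[OF a, of c] c h by auto
qed

section \<open>The expansion as a trivalent map\<close>

lemma exp_arcs_iff [simp]:
  "Old a \<in> exp_arcs F M \<longleftrightarrow> a \<in> ars \<and> a \<notin> D"
  "Across a \<in> exp_arcs F M \<longleftrightarrow> a \<in> D"
  "AcrossRev a \<in> exp_arcs F M \<longleftrightarrow> a \<in> D"
  "LeftSide a \<in> exp_arcs F M \<longleftrightarrow> a \<in> D"
  "RightSide a \<in> exp_arcs F M \<longleftrightarrow> a \<in> D"
  by (auto simp: exp_arcs_def)

lemma arcs_E: "arcs (skel E) = exp_arcs F M"
  by (simp add: expansion_def)

lemma rot_E: "x \<in> exp_arcs F M \<Longrightarrow> rot E x = exp_rot F M x"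
  and opp_E: "x \<in> exp_arcs F M \<Longrightarrow> opp E x = exp_opp F x"
  by (simp_all add: expansion_def)

lemma exp_rot_in: "x \<in> exp_arcs F M \<Longrightarrow> exp_rot F M x \<in> exp_arcs F M"
  by (cases x) (auto simp: inv_rot rot_notin_D rot_rot_notin_D D_ars)

lemma exp_rot3:
  assumes "x \<in> exp_arcs F M"
  shows "exp_rot F M (exp_rot F M (exp_rot F M x)) = x"
  using assms by (cases x) (auto simp: inv_rot rot_notin_D rot_rot_notin_D D_ars)

lemma exp_opp_in: "x \<in> exp_arcs F M \<Longrightarrow> exp_opp F x \<in> exp_arcs F M"
  by (cases x) auto

lemma exp_opp_opp: "exp_opp F (exp_opp F x) = x"
  by (cases x) auto

lemma finite_D: "finite D"
  using finite_arcs by (simp add: arcs_of_def)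

lemma trivalent_E: "trivalent_map E"
proof
  show "finite (arcs (skel E))"
    using finite_arcs finite_D by (simp add: arcs_E exp_arcs_def)
  show "rot E permutes arcs (skel E)"
  proof (rule bij_imp_permutes)
    show "bij_betw (rot E) (arcs (skel E)) (arcs (skel E))"
      unfolding arcs_E
      by (rule bij_betw_byWitness[where f' = "\<lambda>x. rot E (rot E x)"])
         (auto simp: rot_E exp_rot_in exp_rot3)
  qed (simp add: expansion_def)
  show "opp E permutes arcs (skel E)"
  proof (rule bij_imp_permutes)
    show "bij_betw (opp E) (arcs (skel E)) (arcs (skel E))"
      unfolding arcs_E
      by (rule bij_betw_byWitness[where f' = "opp E"])
         (auto simp: opp_E exp_opp_in exp_opp_opp)
  qed (simp add: expansion_def)
  show "opp E (opp E x) = x" if "x \<in> arcs (skel E)" for x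
    using that by (simp add: arcs_E opp_E exp_opp_in exp_opp_opp)
  show "opp E x \<noteq> x" if "x \<in> arcs (skel E)" for x
    using that opp_neq by (cases x) (auto simp: arcs_E opp_E)
  show "rot E (rot E (rot E x)) = x" if "x \<in> arcs (skel E)" for x
    using that by (simp add: arcs_E rot_E exp_rot_in exp_rot3)
qed

end

sublocale clar_map \<subseteq> E: trivalent_map "expansion F M"
  by (rule trivalent_E)

section \<open>Faces of the expansion in terms of the faces of the fullerene\<close>

context clar_map
begin

fun quad_arc :: "'a exp_arc \<Rightarrow> bool" where
  "quad_arc (Across d) = True"
| "quad_arc (RightSide d) = True"
| "quad_arc _ = False"

text \<open>
  Outside the new quadrilaterals, \<open>x\<close> lies on the face that grew out of the face of \<open>base x\<close>. The
  values at \<open>Across\<close> and \<open>RightSide\<close> are irrelevant.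
\<close>

fun base :: "'a exp_arc \<Rightarrow> 'a" where
  "base (AcrossRev d) = r d"
| "base (Old a) = a"
| "base (LeftSide a) = a"
| "base (Across a) = a"
| "base (RightSide a) = a"

text \<open>A section of \<open>base\<close>: the arc that takes the place of \<open>a\<close> on
  its left face. If the edge of \<open>a\<close> is widened, this is the side of the quadrilateral
  to the left of \<open>a\<close>.\<close>

definition canon :: "'a \<Rightarrow> 'a exp_arc" where
  "canon a = (if a \<in> D then LeftSide a else Old a)"

lemma face_succ_E:
  assumes "x \<in> exp_arcs F M"
  shows "face_succ E x = exp_rot F M (exp_rot F M (exp_opp F x))"
  using assms by (simp add: E.face_succ_eq opp_E rot_E exp_opp_in exp_rot_in)

lemma face_succ_E_simps:
  "d \<in> D \<Longrightarrow> face_succ E (Across d) = RightSide d"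
  "d \<in> D \<Longrightarrow> face_succ E (RightSide d) = Across (o' d)"
  "d \<in> D \<Longrightarrow> face_succ E (AcrossRev d) = Old (r d)"
  "d \<in> D \<Longrightarrow> face_succ E (LeftSide d) = Old (g d)"
  "a \<in> ars \<Longrightarrow> a \<notin> D \<Longrightarrow> face_succ E (Old a) =
     (if r (o' a) \<in> D then AcrossRev (r (o' a)) else canon (g a))"
  by (auto simp: face_succ_E inv_rot rot_notin_D rot_rot_notin_D canon_def face_succ_eq)

lemma canon_in [simp]: "canon a \<in> exp_arcs F M \<longleftrightarrow> a \<in> ars"
  using D_ars by (auto simp: canon_def)

lemma base_canon [simp]: "base (canon a) = a" and quad_canon [simp]: "\<not> quad_arc (canon a)"
  by (simp_all add: canon_def)

lemma base_in_ars: "x \<in> exp_arcs F M \<Longrightarrow> base x \<in> ars"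
  using D_ars by (cases x) auto

lemma face_at_E_canon:
  assumes "x \<in> exp_arcs F M" "\<not> quad_arc x"
  shows "face_at E x = face_at E (canon (base x))"
proof (cases x)
  case (AcrossRev d)
  then have d: "d \<in> D" using assms by simp
  then have "face_succ E x = canon (base x)"
    using AcrossRev by (simp add: face_succ_E_simps canon_def rot_notin_D)
  then show ?thesis by (metis E.face_at_face_succ)
qed (use assms in \<open>auto simp: canon_def\<close>)

text \<open>Between consecutive arcs of an old face the expansion inserts at most one arc, an
  \<open>AcrossRev\<close> where a matching edge leaves the face, so one or two steps
  suffice.\<close>

lemma face_at_E_canon_succ:
  assumes "a \<in> ars"
  shows "face_at E (canon (g a)) = face_at E (canon a)"
proof (cases "a \<in> D")
  case True
  then have "g a \<notin> D" using rot_rot_notin_D[of "o' a"] by (simp add: face_succ_eq)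
  then have "face_succ E (canon a) = canon (g a)"
    using True by (simp add: canon_def face_succ_E_simps)
  then show ?thesis by (metis E.face_at_face_succ)
next
  case False
  show ?thesis
  proof (cases "r (o' a) \<in> D")
    case True
    then have "g a \<notin> D" using rot_notin_D[of "r (o' a)"] by (simp add: face_succ_eq)
    then have "face_succ E (face_succ E (canon a)) = canon (g a)"
      using True False assms by (simp add: canon_def face_succ_E_simps) (simp add: face_succ_eq)
    then show ?thesis by (metis E.face_at_face_succ)
  next
    case no: False
    then have "face_succ E (canon a) = canon (g a)"
      using False assms by (simp add: canon_def[of a] face_succ_E_simps)
    then show ?thesis by (metis E.face_at_face_succ)
  qed
qed

lemma face_at_E_canon_eq:
  assumes "a \<in> ars" "L a = L b"
  shows "face_at E (canon a) = face_at E (canon b)"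
proof -
  have b: "b \<in> orbit g a"
    using self_in_face_at[of b] assms(2) by (simp add: face_at_def)
  then have "b \<in> ars \<and> face_at E (canon b) = face_at E (canon a)"
    by induct (use assms(1) face_at_E_canon_succ in auto)
  then show ?thesis by simp
qed

lemma face_at_E_step:
  assumes "x \<in> exp_arcs F M" "\<not> quad_arc x"
  shows "\<not> quad_arc (face_succ E x) \<and> L (base (face_succ E x)) = L (base x)"
proof (cases x)
  case (Old a)
  have "L (r (r (o' a))) = L a" using face_at_face_succ[of a] by (simp add: face_succ_eq)
  then show ?thesis using Old assms by (auto simp: face_succ_E_simps)
qed (use assms in \<open>auto simp: face_succ_E_simps\<close>)

lemma in_face_at_E:
  assumes "x \<in> exp_arcs F M" "\<not> quad_arc x" "y \<in> face_at E x"
  shows "y \<in> exp_arcs F M \<and> \<not> quad_arc y \<and> L (base y) = L (base x)"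
proof -
  have "y \<in> orbit (face_succ E) x" using assms(3) by (simp add: face_at_def)
  then show ?thesis
  proof induct
    case base
    then show ?case using face_at_E_step[OF assms(1,2)] assms(1) E.face_succ_in_iff[of x]
      by (simp add: arcs_E)
  next
    case (step y)
    then show ?case using face_at_E_step[of y] E.face_succ_in_iff[of y]
      by (simp add: arcs_E)
  qed
qed

text \<open>\<open>L (base x)\<close> is constant along the face walk, which gives one direction;
  for the other, every arc is moved to its canonical one, and these follow the old face.\<close>

lemma face_at_E_eq_iff:
  assumes "x \<in> exp_arcs F M" "\<not> quad_arc x" "y \<in> exp_arcs F M" "\<not> quad_arc y"
  shows "face_at E x = face_at E y \<longleftrightarrow> L (base x) = L (base y)"
proof
  assume "face_at E x = face_at E y"
  then have "y \<in> face_at E x" using E.self_in_face_at[of y] by simp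
  from in_face_at_E[OF assms(1,2) this] show "L (base x) = L (base y)" by simp
next
  assume "L (base x) = L (base y)"
  then show "face_at E x = face_at E y"
    using face_at_E_canon[OF assms(1,2)] face_at_E_canon[OF assms(3,4)]
      face_at_E_canon_eq[OF base_in_ars[OF assms(1)]] by simp
qed

definition lift :: "'a set \<Rightarrow> 'a exp_arc set" where
  "lift f = {y \<in> exp_arcs F M. \<not> quad_arc y \<and> base y \<in> f}"

lemma face_at_E_lift:
  assumes "x \<in> exp_arcs F M" "\<not> quad_arc x"
  shows "face_at E x = lift (L (base x))"
proof (rule set_eqI)
  fix y
  have "y \<in> face_at E x" if "y \<in> exp_arcs F M" "\<not> quad_arc y" "L (base y) = L (base x)"
    using face_at_E_eq_iff[OF assms that(1,2)] that(3) E.in_face_at_iff[of y x] by metis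
  then show "y \<in> face_at E x \<longleftrightarrow> y \<in> lift (L (base x))"
    using in_face_at_E[OF assms, of y] in_face_at_iff[of "base y" "base x"]
    unfolding lift_def mem_Collect_eq by metis
qed

lemma face_at_E_Across:
  assumes "d \<in> D"
  shows "face_at E (Across d) = {Across d, RightSide d, Across (o' d), RightSide (o' d)}"
    (is "_ = ?Q")
proof (intro equalityI subsetI)
  fix y assume "y \<in> face_at E (Across d)"
  then have "y \<in> orbit (face_succ E) (Across d)" by (simp add: face_at_def)
  then show "y \<in> ?Q" by induct (use assms in \<open>auto simp: face_succ_E_simps\<close>)
next
  fix y assume y: "y \<in> ?Q"
  have "face_succ E (Across d) = RightSide d" "face_succ E (RightSide d) = Across (o' d)"
    "face_succ E (Across (o' d)) = RightSide (o' d)"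
    using assms by (simp_all add: face_succ_E_simps)
  then have "face_at E y = face_at E (Across d)" using y by (metis E.face_at_face_succ empty_iff insert_iff)
  then show "y \<in> face_at E (Across d)" by (simp add: E.in_face_at_iff)
qed

lemma lift_H: "h \<in> H \<Longrightarrow> lift h = Old ` h"
proof (intro equalityI subsetI)
  fix y assume h: "h \<in> H" and y: "y \<in> lift h"
  have b: "L (base y) \<in> H" using h y H_faces face_eqI by (auto simp: lift_def)
  show "y \<in> Old ` h"
    using y b D_notin_H by (cases y) (auto simp: lift_def)
next
  fix y assume h: "h \<in> H" and "y \<in> Old ` h"
  then obtain a where a: "y = Old a" "a \<in> h" by blast
  then have "a \<in> ars" "L a \<in> H" using h H_faces face_subset face_eqI by auto
  then show "y \<in> lift h" using a D_notin_H(1)[of a] by (auto simp: lift_def)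
qed

lemma face_at_E_in_S_iff:
  assumes x: "x \<in> exp_arcs F M"
  shows "face_at E x \<in> S \<longleftrightarrow> quad_arc x \<or> L (base x) \<in> H"
proof (cases "quad_arc x")
  case True
  have "face_at E (RightSide d) = face_at E (Across d)" if "d \<in> D" for d
    using E.face_at_face_succ[of "Across d"] that by (simp add: face_succ_E_simps)
  then show ?thesis using True x by (cases x) (auto simp: new_quads_def)
next
  case False
  have "face_at E x \<notin> new_quads F M"
  proof
    assume "face_at E x \<in> new_quads F M"
    then obtain d where "face_at E x = face_at E (Across d)" by (auto simp: new_quads_def)
    then have "Across d \<in> face_at E x" using E.self_in_face_at[of "Across d"] by simp
    then show False using in_face_at_E[OF x False, of "Across d"] by simp
  qed
  moreover have "face_at E x \<in> kept_faces H \<longleftrightarrow> L (base x) \<in> H"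
  proof
    assume "face_at E x \<in> kept_faces H"
    then obtain h where h: "h \<in> H" "face_at E x = Old ` h" by (auto simp: kept_faces_def)
    then have "x \<in> lift h" using lift_H E.self_in_face_at[of x] by simp
    then have "base x \<in> h" by (simp add: lift_def)
    then have "L (base x) = h" using h H_faces face_eqI by blast
    then show "L (base x) \<in> H" using h by simp
  next
    assume "L (base x) \<in> H"
    then show "face_at E x \<in> kept_faces H"
      using face_at_E_lift[OF x False] lift_H by (simp add: kept_faces_def)
  qed
  ultimately show ?thesis using False by simp
qed

text \<open>At a half of a split vertex only the new quadrilateral is in \<open>S\<close>, because
  the vertex of \<open>W\<close> it comes from lies on no face of \<open>H\<close>. A whole vertex
  lies on a face of \<open>H\<close>, and on only one since these are disjoint.\<close>

lemma leapfrog_E: "leapfrog E S"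
proof
  show "S \<subseteq> faces E"
  proof
    fix s assume "s \<in> S"
    then consider h where "h \<in> H" "s = Old ` h" | d where "d \<in> D" "s = face_at E (Across d)"
      by (auto simp: kept_faces_def new_quads_def)
    then show "s \<in> faces E"
    proof cases
      case 1
      then obtain a where a: "a \<in> h" using H_faces face_nonempty by blast
      then have "Old a \<in> lift h" using lift_H[OF 1(1)] by simp
      then have "Old a \<in> exp_arcs F M" by (simp add: lift_def)
      moreover have "L a = h" using 1(1) a H_faces face_eqI by blast
      ultimately have "face_at E (Old a) = s" using 1 face_at_E_lift[of "Old a"] lift_H by simp
      then show ?thesis using \<open>Old a \<in> exp_arcs F M\<close> E.face_at_in_faces by (metis arcs_E)
    next
      case 2
      then show ?thesis using E.face_at_in_faces[of "Across d"] by (simp add: arcs_E)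
    qed
  qed
next
  fix x assume "x \<in> arcs (skel E)" and S: "face_at E x \<in> S"
  then have x: "x \<in> exp_arcs F M" by (simp add: arcs_E)
  have "\<not> (quad_arc (exp_rot F M x) \<or> L (base (exp_rot F M x)) \<in> H)"
    using x S[unfolded face_at_E_in_S_iff[OF x]] D_notin_H rot_notin_H
      D_notin_H(2)[of "r (r (base x))"] D_notin_H(3)[of "r (base x)"]
    by (cases x) (auto simp: inv_rot)
  then show "face_at E (rot E x) \<notin> S"
    using face_at_E_in_S_iff[OF exp_rot_in[OF x]] by (simp add: rot_E x)
next
  fix x assume "x \<in> arcs (skel E)"
  then have x: "x \<in> exp_arcs F M" by (simp add: arcs_E)
  let ?q = "\<lambda>x. quad_arc x \<or> L (base x) \<in> H"
  have "?q x \<or> ?q (exp_rot F M x) \<or> ?q (exp_rot F M (exp_rot F M x))"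
    using x D_or_H[of "base x"]
    by (cases x) (auto simp: inv_rot rot_notin_D rot_rot_notin_D)
  then show "face_at E x \<in> S \<or> face_at E (rot E x) \<in> S \<or> face_at E (rot E (rot E x)) \<in> S"
    using x exp_rot_in face_at_E_in_S_iff by (simp add: rot_E)
qed

end

section \<open>The parent of the expansion\<close>

sublocale clar_map \<subseteq> P: leapfrog "expansion F M" "kept_faces H \<union> new_quads F M"
  by (rule leapfrog_E)

context clar_map
begin

abbreviation "P \<equiv> parent E S"
abbreviation "K \<equiv> dual_arcs E S"

section \<open>Simplicity and connectedness of the parent\<close>

lemma K_Old_iff: "Old a \<in> K \<longleftrightarrow> a \<in> ars \<and> a \<notin> D \<and> L a \<notin> H \<and> L (o' a) \<notin> H"
  unfolding dual_arcs_def mem_Collect_eq arcs_E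
  using face_at_E_in_S_iff[of "Old a"] face_at_E_in_S_iff[of "Old (o' a)"]
  by (auto simp: opp_E simp del: Un_iff)

text \<open>Every arc other than an \<open>Old\<close> one has a new quadrilateral on one of its
  sides.\<close>

lemma K_cases:
  assumes "x \<in> K"
  obtains a where "x = Old a" "a \<in> ars" "a \<notin> D" "L a \<notin> H" "L (o' a) \<notin> H"
proof -
  have x: "x \<in> exp_arcs F M" "face_at E x \<notin> S" "face_at E (exp_opp F x) \<notin> S"
    using assms by (auto simp: dual_arcs_def arcs_E opp_E)
  have "\<not> quad_arc x" "\<not> quad_arc (exp_opp F x)"
    using x(2,3) face_at_E_in_S_iff[OF x(1)] face_at_E_in_S_iff[OF exp_opp_in[OF x(1)]] by blast+
  then obtain a where "x = Old a" by (cases x) auto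
  then show ?thesis using that assms K_Old_iff by blast
qed

lemma face_at_E_Old_eq_iff:
  "a \<in> ars \<Longrightarrow> a \<notin> D \<Longrightarrow> b \<in> ars \<Longrightarrow> b \<notin> D \<Longrightarrow>
    face_at E (Old a) = face_at E (Old b) \<longleftrightarrow> L a = L b"
  using face_at_E_eq_iff[of "Old a" "Old b"] by simp

text \<open>Crossed arcs are old and inherit their two side faces. A loop would be an edge with one
  face on both sides, and parallel edges would be two edges shared by the same faces.\<close>

lemma simple_P: "simple_rotation_system P"
proof (rule P.simple_rotation_system_P)
  fix x assume "x \<in> K"
  then obtain a where a: "x = Old a" "a \<in> ars" "a \<notin> D" by (rule K_cases)
  then show "face_at E (opp E x) \<noteq> face_at E x"
    using face_at_E_Old_eq_iff[of "o' a" a] face_at_opp_neq[of a] by (simp add: opp_E)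
next
  fix x y
  assume "x \<in> K" "y \<in> K" and eq: "face_at E x = face_at E y" "face_at E (opp E x) = face_at E (opp E y)"
  from \<open>x \<in> K\<close> obtain a where a: "x = Old a" "a \<in> ars" "a \<notin> D" by (rule K_cases)
  from \<open>y \<in> K\<close> obtain b where b: "y = Old b" "b \<in> ars" "b \<notin> D" by (rule K_cases)
  have "L a = L b" "L (o' a) = L (o' b)"
    using eq a b face_at_E_Old_eq_iff[of a b] face_at_E_Old_eq_iff[of "o' a" "o' b"]
    by (simp_all add: opp_E)
  then show "x = y" using faces_share_at_most_one_edge[of a b] a b by simp
qed

definition vert :: "'a \<Rightarrow> 'a exp_arc set" where
  "vert a = face_at E (canon a)"

lemma vert_eq: "a \<in> ars \<Longrightarrow> L a = L b \<Longrightarrow> vert a = vert b"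
  by (simp add: vert_def face_at_E_canon_eq)

lemma vert_lift: "a \<in> ars \<Longrightarrow> vert a = lift (L a)"
  using face_at_E_lift[of "canon a"] by (simp add: vert_def)

lemma verts_P_iff: "v \<in> faces E - S \<longleftrightarrow> (\<exists>a\<in>ars. L a \<notin> H \<and> v = vert a)"
proof
  assume v: "v \<in> faces E - S"
  then obtain x where x: "x \<in> exp_arcs F M" "v = face_at E x" by (auto simp: faces_def arcs_E)
  then have q: "\<not> quad_arc x" "L (base x) \<notin> H" using v face_at_E_in_S_iff[OF x(1)] by blast+
  then have "v = vert (base x)" using face_at_E_canon[OF x(1)] x(2) by (simp add: vert_def)
  then show "\<exists>a\<in>ars. L a \<notin> H \<and> v = vert a" using q base_in_ars[OF x(1)] by blast
next
  assume "\<exists>a\<in>ars. L a \<notin> H \<and> v = vert a"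
  then obtain a where a: "a \<in> ars" "L a \<notin> H" "v = vert a" by blast
  then have "v \<notin> S" using face_at_E_in_S_iff[of "canon a"] by (simp add: vert_def)
  moreover have "v \<in> faces E"
    using a E.face_at_in_faces[of "canon a"] by (simp add: vert_def arcs_E)
  ultimately show "v \<in> faces E - S" by blast
qed

lemma Old_adj:
  assumes "a \<in> ars" "a \<notin> D" "L a \<notin> H" "L (o' a) \<notin> H"
  shows "vert a \<rightarrow>\<^sup>*\<^bsub>skel P\<^esub> vert (o' a)"
proof -
  interpret P0: simple_rotation_system P by (rule simple_P)
  interpret G: graph "skel P" by (rule P0.simple_graph)
  have "Old a \<in> K" using assms by (simp add: K_Old_iff)
  moreover have "vert a = face_at E (Old a)" "vert (o' a) = face_at E (opp E (Old a))"
    using assms by (simp_all add: vert_def canon_def opp_E)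
  ultimately show ?thesis
    by (intro G.reachable_adjI) (auto simp: arcs_ends_conv P.arcs_P P.tail_P P.head_P intro!: image_eqI)
qed

lemma reach_sym: "u \<rightarrow>\<^sup>*\<^bsub>skel P\<^esub> v \<Longrightarrow> v \<rightarrow>\<^sup>*\<^bsub>skel P\<^esub> u"
proof -
  interpret P0: simple_rotation_system P by (rule simple_P)
  interpret G: graph "skel P" by (rule P0.simple_graph)
  show "u \<rightarrow>\<^sup>*\<^bsub>skel P\<^esub> v \<Longrightarrow> v \<rightarrow>\<^sup>*\<^bsub>skel P\<^esub> u" by (rule G.symmetric_reachable')
qed

lemma reach_trans: "u \<rightarrow>\<^sup>*\<^bsub>skel P\<^esub> v \<Longrightarrow> v \<rightarrow>\<^sup>*\<^bsub>skel P\<^esub> w \<Longrightarrow> u \<rightarrow>\<^sup>*\<^bsub>skel P\<^esub> w"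
proof -
  interpret P0: simple_rotation_system P by (rule simple_P)
  interpret G: graph "skel P" by (rule P0.simple_graph)
  show "u \<rightarrow>\<^sup>*\<^bsub>skel P\<^esub> v \<Longrightarrow> v \<rightarrow>\<^sup>*\<^bsub>skel P\<^esub> w \<Longrightarrow> u \<rightarrow>\<^sup>*\<^bsub>skel P\<^esub> w" by (rule G.reachable_trans)
qed

text \<open>The edge of \<open>r a\<close> separates the two faces. If it lies in \<open>M\<close>
  and cannot be crossed, the third face at the vertex is outside \<open>H\<close> and offers a
  detour of two steps.\<close>

lemma vert_rot:
  assumes a: "a \<in> ars" and H: "L a \<notin> H" "L (r a) \<notin> H"
  shows "vert a \<rightarrow>\<^sup>*\<^bsub>skel P\<^esub> vert (r a)"
proof -
  have adj: "vert (r b) \<rightarrow>\<^sup>*\<^bsub>skel P\<^esub> vert b"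
    if "b \<in> ars" "r b \<notin> D" "L (r b) \<notin> H" "L b \<notin> H" for b
  proof -
    have "L (o' (r b)) = L b" by (simp add: face_at_opp_eq)
    then show ?thesis using Old_adj[of "r b"] vert_eq[of "o' (r b)" b] that by simp
  qed
  show ?thesis
  proof (cases "r a \<in> D")
    case False
    then show ?thesis using adj[of a] a H reach_sym by blast
  next
    case True
    have "L (r (r a)) \<notin> H" "r (r a) \<notin> D" "a \<notin> D"
      using D_notin_H(2)[OF True] rot_notin_D[OF True] rot_rot_notin_D[OF True] by simp_all
    then have "vert (r (r a)) \<rightarrow>\<^sup>*\<^bsub>skel P\<^esub> vert (r a)" "vert a \<rightarrow>\<^sup>*\<^bsub>skel P\<^esub> vert (r (r a))"
      using adj[of "r a"] adj[of "r (r a)"] a H by simp_all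
    then show ?thesis using reach_trans by blast
  qed
qed

text \<open>The property spread over all arcs is that every face outside \<open>H\<close> around the
  tail is reachable from \<open>f\<close>. \<open>R\<close> is conditional because faces of
  \<open>H\<close> are not vertices of the parent.\<close>

lemma conn_P:
  assumes "f \<in> faces E - S" "f' \<in> faces E - S"
  shows "f \<rightarrow>\<^sup>*\<^bsub>skel P\<^esub> f'"
proof -
  obtain a where a: "a \<in> ars" "L a \<notin> H" "f = vert a" using assms(1) verts_P_iff by blast
  obtain b where b: "b \<in> ars" "L b \<notin> H" "f' = vert b" using assms(2) verts_P_iff by blast
  define R where "R c \<longleftrightarrow> L c \<notin> H \<longrightarrow> f \<rightarrow>\<^sup>*\<^bsub>skel P\<^esub> vert c" for c
  let ?Q = "\<lambda>c. R c \<and> R (r c) \<and> R (r (r c))"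
  have Q: "?Q c" if c: "c \<in> ars" "L c \<notin> H" "f \<rightarrow>\<^sup>*\<^bsub>skel P\<^esub> vert c" for c
    using c vert_rot[of c] vert_rot[of "r (r c)"] reach_trans reach_sym
    unfolding R_def rot_rot_rot rot_in_iff by blast
  have refl: "f \<rightarrow>\<^sup>*\<^bsub>skel P\<^esub> f"
  proof -
    interpret P0: simple_rotation_system P by (rule simple_P)
    interpret G: graph "skel P" by (rule P0.simple_graph)
    show ?thesis using assms(1) by (intro G.reachable_refl) (simp only: P.verts_P)
  qed
  have "?Q b"
  proof (rule arcs_closed_induct[where P = ?Q, OF b(1) a(1)])
    show "?Q a" using Q[OF a(1,2)] refl a(3) by simp
  next
    fix c assume "c \<in> ars" "?Q c"
    then show "?Q (r c)" by simp
  next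
    fix c assume c: "c \<in> ars" and Qc: "?Q c"
    have oc: "o' c \<in> ars" "r (r (o' c)) \<in> ars" using c by simp_all
    have e1: "L (o' c) = L (r (r c))" by (rule face_at_opp_eq)
    have e2: "L (r (r (o' c))) = L c" using face_at_opp_eq[of "o' c"] by simp
    show "?Q (o' c)"
    proof (cases "L (o' c) \<in> H")
      case False
      then have "f \<rightarrow>\<^sup>*\<^bsub>skel P\<^esub> vert (o' c)"
        using Qc e1 vert_eq[OF oc(1) e1] by (simp add: R_def)
      then show ?thesis using Q[OF oc(1) False] by blast
    next
      case True
      \<comment> \<open>The two sides of an edge are not both in \<open>H\<close>, so the walk
        continues from the left face of \<open>c\<close>.\<close>
      then have *: "L (r (r (o' c))) \<notin> H" using rot_notin_H[OF oc(2)] by auto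
      then have "f \<rightarrow>\<^sup>*\<^bsub>skel P\<^esub> vert (r (r (o' c)))"
        using Qc e2 vert_eq[OF oc(2) e2] by (simp add: R_def)
      then show ?thesis using Q[OF oc(2) *] by simp
    qed
  qed
  then show ?thesis using b by (simp add: R_def)
qed

section \<open>Counting the faces and arcs of the expansion\<close>

lemma card_new_quad: "d \<in> D \<Longrightarrow> card (face_at E (Across d)) = 4"
  using opp_neq[of d] D_ars[of d] by (auto simp: face_at_E_Across)

lemma Union_new_quads: "\<Union> (new_quads F M) = Across ` D \<union> RightSide ` D"
proof -
  have "\<Union> (new_quads F M) = (\<Union>d\<in>D. {Across d, RightSide d, Across (o' d), RightSide (o' d)})"
    unfolding new_quads_def using face_at_E_Across by auto
  also have "\<dots> = Across ` D \<union> RightSide ` D" by auto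
  finally show ?thesis .
qed

lemma card_D: "card D = card W"
proof (rule bij_betw_same_card[of "tail (skel F)"])
  have "v \<in> tail (skel F) ` D" if v: "v \<in> W" for v
  proof -
    obtain e where e: "e \<in> M" "v \<in> e" using M_covers[OF v] by blast
    then obtain b where b: "b \<in> ars" "e = edge_of F b" using M_edges by (auto simp: edges_def)
    then have bD: "b \<in> D" using e by (simp add: arcs_of_def)
    have "v = tail (skel F) b \<or> v = tail (skel F) (o' b)"
      using e(2) b by (auto simp: edge_of_def tail_opp)
    then show ?thesis using bD opp_D by (metis imageI)
  qed
  then show "bij_betw (tail (skel F)) D W"
    unfolding bij_betw_def inj_on_def using inj_on_tail_D tail_D by blast
qed

lemma new_quads_subset: "new_quads F M \<subseteq> faces E" and kept_faces_subset: "kept_faces H \<subseteq> faces E"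
  using P.S_subset by simp_all

lemma card_new_quads: "2 * card (new_quads F M) = card D"
proof -
  have "card (\<Union> (new_quads F M)) = (\<Sum>f\<in>new_quads F M. card f)"
    by (rule E.card_Union_faces[OF new_quads_subset])
  also have "\<dots> = (\<Sum>f\<in>new_quads F M. 4)"
    by (rule sum.cong) (auto simp: new_quads_def card_new_quad)
  finally have "card (\<Union> (new_quads F M)) = 4 * card (new_quads F M)" by simp
  moreover have "card (\<Union> (new_quads F M)) = 2 * card D"
    unfolding Union_new_quads using finite_D
    by (subst card_Un_disjoint) (auto simp: card_image inj_on_def)
  ultimately show ?thesis by simp
qed

lemma finite_H: "finite H"
  using H_faces finite_faces finite_subset by blast

lemma card_kept_face: "s \<in> kept_faces H \<Longrightarrow> card s = 6"
  using H_hexagon by (auto simp: kept_faces_def card_image inj_on_def)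

lemma card_kept_faces: "card (kept_faces H) = card H"
  unfolding kept_faces_def
  by (intro card_image inj_onI) (simp add: inj_image_eq_iff[of Old] inj_def)

lemma finite_new_quads: "finite (new_quads F M)" and finite_kept_faces: "finite (kept_faces H)"
  using finite_D finite_H by (simp_all add: new_quads_def kept_faces_def)

lemma card_of_new_quad: "s \<in> new_quads F M \<Longrightarrow> card s = 4"
  by (auto simp: new_quads_def card_new_quad)

lemma disjoint_S: "kept_faces H \<inter> new_quads F M = {}"
  using card_kept_face card_of_new_quad by fastforce

lemma card_S: "card S = card H + card (new_quads F M)"
  using card_Un_disjoint[OF finite_kept_faces finite_new_quads disjoint_S] by (simp add: card_kept_faces)

lemma card_Union_S: "card (\<Union> S) = 6 * card H + 4 * card (new_quads F M)"
proof -
  have "card (\<Union> S) = (\<Sum>s\<in>S. card s)" by (rule E.card_Union_faces[OF P.S_subset])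
  also have "\<dots> = (\<Sum>s\<in>kept_faces H. card s) + (\<Sum>s\<in>new_quads F M. card s)"
    by (rule sum.union_disjoint[OF finite_kept_faces finite_new_quads disjoint_S])
  also have "\<dots> = (\<Sum>s\<in>kept_faces H. 6) + (\<Sum>s\<in>new_quads F M. 4)"
    using card_kept_face card_of_new_quad by simp
  finally show ?thesis by (simp add: card_kept_faces)
qed

lemma verts_P_eq: "faces E - S = lift ` (faces F - H)"
proof -
  have eq: "faces F - H = L ` {a \<in> ars. L a \<notin> H}" by (auto simp: faces_def)
  have "lift ` (faces F - H) = vert ` {a \<in> ars. L a \<notin> H}"
    unfolding eq image_image using vert_lift by (intro image_cong) auto
  moreover have "v \<in> faces E - S \<longleftrightarrow> v \<in> vert ` {a \<in> ars. L a \<notin> H}" for v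
    unfolding verts_P_iff image_iff mem_Collect_eq by blast
  ultimately show ?thesis by (intro set_eqI) simp
qed

lemma inj_on_lift: "inj_on lift (faces F)"
proof (rule inj_onI)
  fix f h assume f: "f \<in> faces F" and h: "h \<in> faces F" and eq: "lift f = lift h"
  obtain a where a: "a \<in> f" using face_nonempty[OF f] by blast
  then have "a \<in> ars" using face_subset[OF f] by blast
  then have "canon a \<in> lift f" using a by (simp add: lift_def)
  then have "canon a \<in> lift h" using eq by simp
  then have "a \<in> h" by (simp add: lift_def)
  then show "f = h" using face_eqI[OF f a] face_eqI[OF h] by simp
qed

lemma card_verts_P: "card (faces E - S) + card H = card (faces F)"
proof -
  have "card (faces E - S) = card (faces F - H)"
    unfolding verts_P_eq by (intro card_image inj_on_subset[OF inj_on_lift]) blast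
  moreover have "card (faces F - H) = card (faces F) - card H"
    by (rule card_Diff_subset[OF finite_H H_faces])
  moreover have "card H \<le> card (faces F)" by (rule card_mono[OF finite_faces H_faces])
  ultimately show ?thesis by simp
qed

lemma card_W: "card W + 6 * card H = card (verts (skel F))"
proof -
  have sub: "\<Union> (face_verts F ` H) \<subseteq> verts (skel F)"
    using H_faces face_subset tail_in_verts by (auto simp: face_verts_def)
  have inj: "inj_on (face_verts F) H"
  proof (rule inj_onI)
    fix f h assume fh: "f \<in> H" "h \<in> H" "face_verts F f = face_verts F h"
    have "face_verts F f \<noteq> {}" using fh(1) H_faces face_nonempty by (auto simp: face_verts_def)
    then show "f = h" using H_disjoint[OF fh(1,2)] fh(3) by auto
  qed
  have "card (\<Union> (face_verts F ` H)) = (\<Sum>v\<in>face_verts F ` H. card v)"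
    using H_disjoint H_faces finite_face
    by (intro card_Union_disjoint) (auto simp: pairwise_def disjnt_def face_verts_def subset_iff)
  also have "\<dots> = (\<Sum>h\<in>H. card (face_verts F h))" by (simp add: sum.reindex[OF inj])
  also have "\<dots> = (\<Sum>h\<in>H. 6)"
    using H_faces H_hexagon inj_on_tail by (intro sum.cong refl) (auto simp: face_verts_def card_image subset_iff)
  finally have "card (\<Union> (face_verts F ` H)) = 6 * card H" by simp
  moreover have "card W = card (verts (skel F)) - card (\<Union> (face_verts F ` H))"
    using sub finite_verts by (meson card_Diff_subset finite_subset)
  moreover have "card (\<Union> (face_verts F ` H)) \<le> card (verts (skel F))"
    by (rule card_mono[OF finite_verts sub])
  ultimately show ?thesis by simp
qed

text \<open>If the faces at the two ends of \<open>d\<close> were equal, the edges before and after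
  \<open>d\<close> on \<open>L d\<close> would both be shared with that face, hence be the same, and
  \<open>L d\<close> would have length 2.\<close>

lemma opposite_end_faces_neq:
  assumes d: "d \<in> ars"
  shows "L (r d) \<noteq> L (r (o' d))"
proof
  assume eq: "L (r d) = L (r (o' d))"
  have "L (g d) = L (o' (r d))"
    by (simp add: face_at_opp_eq)
  moreover have "L (o' (g d)) = L (o' (o' (r d)))"
    using eq face_at_opp_eq[of "g d"] by (simp add: face_succ_eq)
  ultimately have "g d = o' (r d)"
    using faces_share_at_most_one_edge[of "g d" "o' (r d)"] d by simp
  then have "g (g d) = d" by (simp add: face_succ_eq[of "o' (r d)"])
  then have "(g ^^ 2) d = d" by (simp add: numeral_eq_Suc)
  moreover have "(g ^^ 2) d \<noteq> d"
    using face_funpow(2)[of "L d" d 2] card_face_at[OF d] d by auto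
  ultimately show False by simp
qed

lemma rot_E_quad_faces:
  assumes d: "d \<in> D"
  shows "face_at E (rot E (Across d)) = vert d"
    "face_at E (rot E (RightSide d)) = vert (r d)"
    "face_at E (rot E (Across (o' d))) = vert (o' d)"
    "face_at E (rot E (RightSide (o' d))) = vert (r (o' d))"
  using d face_at_E_canon[of "LeftSide d"] face_at_E_canon[of "AcrossRev d"]
    face_at_E_canon[of "LeftSide (o' d)"] face_at_E_canon[of "AcrossRev (o' d)"]
  by (simp_all add: rot_E vert_def)

lemma vert_eq_iff: "a \<in> ars \<Longrightarrow> b \<in> ars \<Longrightarrow> vert a = vert b \<longleftrightarrow> L a = L b"
  using face_at_E_eq_iff[of "canon a" "canon b"] by (simp add: vert_def)

text \<open>The four faces around a widened edge are the two along it and the two at its ends. Any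
  two of them meet at an end of the edge, except for the two end faces, which need
  \<open>opposite_end_faces_neq\<close>.\<close>

lemma inj_on_new_quad:
  assumes "s \<in> new_quads F M"
  shows "inj_on (\<lambda>c. face_at E (rot E c)) s"
proof -
  obtain d where d: "d \<in> D" and s: "s = {Across d, RightSide d, Across (o' d), RightSide (o' d)}"
    using assms by (auto simp: new_quads_def face_at_E_Across)
  have ars: "d \<in> ars" using D_ars[OF d] .
  have "L d \<noteq> L (r d)" "L d \<noteq> L (o' d)" "L d \<noteq> L (r (o' d))" "L (r d) \<noteq> L (o' d)"
    "L (r d) \<noteq> L (r (o' d))" "L (o' d) \<noteq> L (r (o' d))"
  proof -
    show "L d \<noteq> L (r d)" using face_at_rot_neq[OF ars] by metis
    show "L d \<noteq> L (o' d)" using face_at_opp_neq[OF ars] by metis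
    show "L (o' d) \<noteq> L (r (o' d))" using face_at_rot_neq[of "o' d"] ars by (metis opp_in_iff)
    show "L (r d) \<noteq> L (r (o' d))" by (rule opposite_end_faces_neq[OF ars])
    have "L d = L (r (r (o' d)))" using face_at_opp_eq[of "o' d"] by simp
    then show "L d \<noteq> L (r (o' d))" using face_at_rot_neq[of "r (o' d)"] ars by simp
    have "L (o' d) = L (r (r d))" by (rule face_at_opp_eq)
    then show "L (r d) \<noteq> L (o' d)" using face_at_rot_neq[of "r d"] ars by simp
  qed
  then have "vert d \<noteq> vert (r d)" "vert d \<noteq> vert (o' d)" "vert d \<noteq> vert (r (o' d))"
    "vert (r d) \<noteq> vert (o' d)" "vert (r d) \<noteq> vert (r (o' d))" "vert (o' d) \<noteq> vert (r (o' d))"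
    using ars by (simp_all add: vert_eq_iff)
  then show ?thesis
    unfolding s inj_on_def by (auto simp: rot_E_quad_faces[OF d])
qed

text \<open>The neighbours of a hexagon in \<open>H\<close> across different edges are different,
  since two faces share at most one edge.\<close>

lemma inj_on_kept_face:
  assumes "s \<in> kept_faces H"
  shows "inj_on (\<lambda>c. face_at E (rot E c)) s"
proof (rule inj_onI)
  obtain h where h: "h \<in> H" "s = Old ` h" using assms by (auto simp: kept_faces_def)
  have hf: "h \<in> faces F" using h H_faces by blast
  have rot: "face_at E (rot E (Old a)) = vert (r a) \<and> a \<in> ars \<and> L a = h" if "a \<in> h" for a
  proof -
    have a: "a \<in> ars" "L a = h" using that hf face_subset face_eqI by blast+
    then have "a \<notin> D" "r a \<notin> D" "r (r a) \<notin> D"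
      using D_notin_H(1)[of a] D_notin_H(3)[of "r a"] D_notin_H(2)[of "r (r a)"] h by auto
    then show ?thesis using a by (simp add: rot_E inv_rot vert_def canon_def)
  qed
  fix x y assume x: "x \<in> s" and y: "y \<in> s" and eq: "face_at E (rot E x) = face_at E (rot E y)"
  obtain a b where ab: "x = Old a" "a \<in> h" "y = Old b" "b \<in> h" using x y h by blast
  have ars: "a \<in> ars" "b \<in> ars" using rot ab by blast+
  then have "L (r a) = L (r b)" using eq ab rot[OF ab(2)] rot[OF ab(4)] by (simp add: vert_eq_iff)
  moreover have "L (o' (r a)) = L (o' (r b))"
    using rot[OF ab(2)] rot[OF ab(4)] by (simp add: face_at_opp_eq)
  ultimately have "r a = r b" using faces_share_at_most_one_edge[of "r a" "r b"] ars by simp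
  then show "x = y" using ab inj_rot by (simp add: inj_eq)
qed

lemma polygon_new_quad: "s \<in> new_quads F M \<Longrightarrow> polygon P 4 (P.dual_arc ` s)"
  using P.polygon_P[of s] inj_on_new_quad[of s] card_of_new_quad[of s] by simp

lemma polygon_kept_face: "s \<in> kept_faces H \<Longrightarrow> polygon P 6 (P.dual_arc ` s)"
  using P.polygon_P[of s] inj_on_kept_face[of s] card_kept_face[of s] by simp

lemma faces_P_polygons: "f \<in> faces P \<Longrightarrow> polygon P 4 f \<or> polygon P 6 f"
  unfolding P.faces_P using polygon_new_quad polygon_kept_face by blast

lemma quads_P: "{f. polygon P 4 f} = (`) P.dual_arc ` new_quads F M"
proof (intro equalityI subsetI)
  fix f assume "f \<in> {f. polygon P 4 f}"
  then have f: "f \<in> faces P" "card f = 4" by (auto simp: polygon_def)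
  then obtain s where s: "s \<in> S" "f = P.dual_arc ` s" unfolding P.faces_P by blast
  have "s \<notin> kept_faces H"
    using polygon_kept_face[of s] s f by (auto simp: polygon_def)
  then show "f \<in> (`) P.dual_arc ` new_quads F M" using s by blast
qed (use polygon_new_quad in blast)

lemma card_quads_P: "card {f. polygon P 4 f} = card (new_quads F M)"
  unfolding quads_P
  by (intro card_image inj_on_subset[OF P.inj_on_image_dual_arc]) simp

text \<open>\<open>r d \<in> f\<close> says that \<open>f\<close> lies opposite to \<open>d\<close>
  at its tail. Widening \<open>d\<close> lengthens \<open>f\<close> there by
  \<open>AcrossRev d\<close>, while the faces along \<open>d\<close> keep their length at this
  edge.\<close>

lemma card_lift:
  assumes f: "f \<in> faces F"
  shows "card (lift f) = card f + card {d \<in> D. r d \<in> f}"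
proof -
  have sub: "a \<in> ars" if "a \<in> f" for a using that face_subset[OF f] by blast
  have "lift f = canon ` f \<union> AcrossRev ` {d \<in> D. r d \<in> f}"
  proof (rule set_eqI)
    fix y
    show "y \<in> lift f \<longleftrightarrow> y \<in> canon ` f \<union> AcrossRev ` {d \<in> D. r d \<in> f}"
      by (cases y) (auto simp: lift_def canon_def image_iff sub split: if_splits)
  qed
  moreover have "inj_on canon f" by (rule inj_on_inverseI[of _ base]) simp
  moreover have "canon ` f \<inter> AcrossRev ` {d \<in> D. r d \<in> f} = {}"
    by (auto simp: canon_def split: if_splits)
  ultimately show ?thesis
    using finite_face[OF f] finite_D by (simp add: card_Un_disjoint card_image inj_on_def)
qed

text \<open>Each matching edge that leaves \<open>f\<close> contributes its quadrilateral, and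
  different ends give different ones because no edge leaves \<open>f\<close> at both ends.\<close>

lemma quads_at_P:
  assumes f: "f \<in> faces F"
  shows "card {d \<in> D. r d \<in> f} \<le> card (quads_at P (lift f))"
proof (rule card_inj_on_le)
  let ?q = "\<lambda>d. P.dual_arc ` face_at E (Across d)"
  show "inj_on ?q {d \<in> D. r d \<in> f}"
  proof (rule inj_onI)
    fix d e assume d: "d \<in> {d \<in> D. r d \<in> f}" and e: "e \<in> {d \<in> D. r d \<in> f}" and "?q d = ?q e"
    then have "face_at E (Across d) = face_at E (Across e)"
      by (simp add: inj_image_eq_iff[OF P.inj_dual_arc])
    then have "Across d \<in> face_at E (Across e)" using E.self_in_face_at[of "Across d"] by simp
    then have "d = e \<or> d = o' e" using e by (simp add: face_at_E_Across)
    moreover have "d \<noteq> o' e"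
    proof
      assume "d = o' e"
      then have "L (r e) = L (r (o' e))" using d e face_eqI[OF f] by simp
      then show False using opposite_end_faces_neq[of e] e D_ars by simp
    qed
    ultimately show "d = e" by blast
  qed
  show "?q ` {d \<in> D. r d \<in> f} \<subseteq> quads_at P (lift f)"
  proof
    fix y assume "y \<in> ?q ` {d \<in> D. r d \<in> f}"
    then obtain d where d: "d \<in> D" "r d \<in> f" "y = ?q d" by blast
    have s: "face_at E (Across d) \<in> new_quads F M" using d by (simp add: new_quads_def)
    have "RightSide d \<in> face_at E (Across d)" using d by (simp add: face_at_E_Across)
    then have "face_at E (rot E (RightSide d)) \<in> face_verts P y"
      unfolding d(3) P.face_verts_P by (rule imageI)
    moreover have "face_at E (rot E (RightSide d)) = lift f"
      using rot_E_quad_faces(2)[OF d(1)] vert_lift[of "r d"] face_eqI[OF f d(2)] D_ars[OF d(1)] by simp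
    ultimately show "y \<in> quads_at P (lift f)"
      using polygon_new_quad[OF s] d(3) by (simp add: quads_at_def)
  qed
  have "quads_at P (lift f) \<subseteq> faces P" by (auto simp: quads_at_def polygon_def)
  moreover have "finite (faces P)" unfolding P.faces_P using P.finite_S by (rule finite_imageI)
  ultimately show "finite (quads_at P (lift f))" by (rule finite_subset)
qed

text \<open>Twice the degree is the length of \<open>f\<close> plus the number of matching edges
  leaving it. Length at least 5 and parity give the lower bound, length at most 6 the upper
  one.\<close>

lemma degree_P_bounds:
  assumes v: "v \<in> verts (skel P)"
  shows "3 \<le> degree P v" and "2 * degree P v \<le> 6 + card (quads_at P v)"
proof -
  obtain f where f: "f \<in> faces F" "v = lift f"
    using v unfolding P.verts_P verts_P_eq by blast
  have "v \<in> faces E - S" using v by (simp only: P.verts_P)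
  then have "2 * degree P v = card f + card {d \<in> D. r d \<in> f}"
    using P.degree_P[of v] card_lift[OF f(1)] f(2) by simp
  then show "3 \<le> degree P v" "2 * degree P v \<le> 6 + card (quads_at P v)"
    using quads_at_P[OF f(1)] card_face[OF f(1)] f(2) by auto
qed

lemma connected_plane_graph_P:
  assumes "card (faces E - S) \<noteq> 0"
  shows "connected_plane_graph P"
proof (rule P.connected_plane_graph_P[OF simple_P])
  show "faces E - S \<noteq> {}" using assms by (metis card.empty)
  \<comment> \<open>With h kept faces and q quadrilaterals, the left side is 2(F - h) - (6h + 4q) +
    2(h + q) = 2F - (6h + 2q), where 6h + 2q is the number of vertices of the fullerene.\<close>
  show "2 * int (card (faces E - S)) - int (card (\<Union> S)) + 2 * int (card S) = 4"
    using card_verts_P card_Union_S card_S card_new_quads card_D card_W euler card_ars card_ars_verts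
    by linarith
qed (rule conn_P)

end

section \<open>Degree sums of the partite sets and the distribution of the excess\<close>

context connected_plane_graph
begin

lemma sum_degree: "A \<subseteq> verts (skel X) \<Longrightarrow> (\<Sum>v\<in>A. degree X v) = card {a \<in> ars. tail (skel X) a \<in> A}"
proof -
  assume A: "A \<subseteq> verts (skel X)"
  have "card {a \<in> ars. tail (skel X) a \<in> A} =
      (\<Sum>v\<in>A. card {a \<in> {a \<in> ars. tail (skel X) a \<in> A}. tail (skel X) a = v})"
    using sum.group[of "{a \<in> ars. tail (skel X) a \<in> A}" A "tail (skel X)" "\<lambda>_. 1::nat"]
      finite_arcs finite_subset[OF A finite_verts] by (simp add: image_subset_iff)
  also have "\<dots> = (\<Sum>v\<in>A. degree X v)"
    by (intro sum.cong refl arg_cong[of _ _ card])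
       (auto simp: degree_def out_degree_def out_arcs_def intro!: arg_cong[of _ _ card])
  finally show ?thesis by simp
qed

text \<open>Reversal exchanges the arcs leaving \<open>A\<close> with those leaving
  \<open>B\<close>, so each set holds half of all arcs.\<close>

lemma bipartition_sum_degree:
  assumes "bipartition X A B"
  shows "(\<Sum>v\<in>A. degree X v) = card (edges X)" "(\<Sum>v\<in>B. degree X v) = card (edges X)"
proof -
  have AB: "A \<union> B = verts (skel X)" "A \<inter> B = {}"
    and e: "\<And>e. e \<in> edges X \<Longrightarrow> \<exists>u\<in>A. \<exists>v\<in>B. e = {u, v}"
    using assms by (auto simp: bipartition_def)
  let ?A = "{a \<in> ars. tail (skel X) a \<in> A}" and ?B = "{a \<in> ars. tail (skel X) a \<in> B}"
  have flip: "tail (skel X) a \<in> A \<longleftrightarrow> head (skel X) a \<in> B" if a: "a \<in> ars" for a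
  proof -
    have "edge_of X a \<in> edges X" using a by (simp add: edges_def)
    from e[OF this] obtain u v where "u \<in> A" "v \<in> B" "{tail (skel X) a, head (skel X) a} = {u, v}"
      by (auto simp: edge_of_def)
    then show ?thesis using AB(2) by (auto simp: doubleton_eq_iff)
  qed
  have "bij_betw (opp X) ?A ?B"
    by (rule bij_betw_byWitness[where f' = "opp X"])
       (use flip in \<open>auto simp: tail_opp\<close>, metis flip head_opp opp_in_iff tail_opp)
  then have "card ?A = card ?B" by (rule bij_betw_same_card)
  moreover have "card ars = card ?A + card ?B"
  proof -
    have "ars = ?A \<union> ?B" using AB(1) tail_in_verts by blast
    moreover have "?A \<inter> ?B = {}" using AB(2) by blast
    ultimately show ?thesis using finite_arcs by (metis (no_types, lifting) card_Un_disjoint finite_Un)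
  qed
  moreover have "(\<Sum>v\<in>A. degree X v) = card ?A" "(\<Sum>v\<in>B. degree X v) = card ?B"
    using AB(1) by (auto intro: sum_degree)
  ultimately show "(\<Sum>v\<in>A. degree X v) = card (edges X)" "(\<Sum>v\<in>B. degree X v) = card (edges X)"
    using card_ars by simp_all
qed

end

lemma sum_eq_2_cases:
  fixes x :: "'b \<Rightarrow> nat"
  assumes "finite A" "(\<Sum>v\<in>A. x v) = 2"
  shows "(\<forall>v\<in>A. x v \<le> 2) \<and> (card {v \<in> A. x v = 1} = 2 \<and> {v \<in> A. x v = 2} = {} \<or>
    {v \<in> A. x v = 1} = {} \<and> card {v \<in> A. x v = 2} = 1)"
proof -
  have le: "x v \<le> 2" if "v \<in> A" for v
    using member_le_sum[of v A x] that assms by simp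
  have "(\<Sum>v\<in>A. x v) = (\<Sum>v\<in>A. (if x v = 1 then 1 else 0) + (if x v = 2 then 2 else 0))"
    by (rule sum.cong) (use le in force)+
  also have "\<dots> = card {v \<in> A. x v = 1} + 2 * card {v \<in> A. x v = 2}"
    using assms(1) by (simp add: sum.distrib sum.If_cases Int_def)
  finally have "card {v \<in> A. x v = 1} + 2 * card {v \<in> A. x v = 2} = 2" using assms(2) by simp
  then have "card {v \<in> A. x v = 1} = 2 \<and> card {v \<in> A. x v = 2} = 0 \<or>
      card {v \<in> A. x v = 1} = 0 \<and> card {v \<in> A. x v = 2} = 1"
    by (cases "card {v \<in> A. x v = 2}") auto
  then show ?thesis using le assms(1) by auto
qed

context connected_plane_graph
begin

text \<open>Subtracting 3 is exact by \<open>ge3\<close>. In each partite set an excess of 2 means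
  one vertex of degree 5 or two of degree 4; of the four combinations, the two mixed ones give the
  same class.\<close>

lemma degree_classes:
  assumes AB: "bipartition X A B"
    and sumA: "(\<Sum>v\<in>A. degree X v - 3) = 2" and sumB: "(\<Sum>v\<in>B. degree X v - 3) = 2"
    and ge3: "\<And>v. v \<in> verts (skel X) \<Longrightarrow> 3 \<le> degree X v"
    and quads: "\<And>v. v \<in> verts (skel X) \<Longrightarrow> 2 * degree X v \<le> 6 + card (quads_at X v)"
  shows "class_5_5 X \<or> class_5_4_4 X \<or> class_4_4_4_4 X"
proof -
  let ?V = "verts (skel X)" and ?V4 = "verts_of_degree X 4" and ?V5 = "verts_of_degree X 5"
  have V: "?V = A \<union> B" and disj: "A \<inter> B = {}" using AB by (auto simp: bipartition_def)
  have fin: "finite A" "finite B" using finite_verts V by auto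
  have BA: "bipartition X B A"
    using AB unfolding bipartition_def by (metis Un_commute Int_commute insert_commute)
  have eq: "{v \<in> C. degree X v - 3 = 1} = C \<inter> ?V4" "{v \<in> C. degree X v - 3 = 2} = C \<inter> ?V5"
    if "C \<subseteq> ?V" for C
    using that by (auto simp: verts_of_degree_def)
  have sub: "A \<subseteq> ?V" "B \<subseteq> ?V" using V by auto
  have a: "(\<forall>v\<in>A. degree X v - 3 \<le> 2) \<and> (card (A \<inter> ?V4) = 2 \<and> A \<inter> ?V5 = {} \<or>
      A \<inter> ?V4 = {} \<and> card (A \<inter> ?V5) = 1)"
    using sum_eq_2_cases[OF fin(1) sumA] unfolding eq[OF sub(1)] .
  have b: "(\<forall>v\<in>B. degree X v - 3 \<le> 2) \<and> (card (B \<inter> ?V4) = 2 \<and> B \<inter> ?V5 = {} \<or>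
      B \<inter> ?V4 = {} \<and> card (B \<inter> ?V5) = 1)"
    using sum_eq_2_cases[OF fin(2) sumB] unfolding eq[OF sub(2)] .
  have deg: "degree X v = 3 \<or> v \<in> ?V4 \<or> v \<in> ?V5" if v: "v \<in> ?V" for v
  proof -
    have "degree X v - 3 \<le> 2" using a b v V by blast
    then have "degree X v = 3 \<or> degree X v = 4 \<or> degree X v = 5" using ge3[OF v] by linarith
    then show ?thesis using v by (auto simp: verts_of_degree_def)
  qed
  \<comment> \<open>The bounds are 2 * 5 - 6 and 2 * 4 - 6.\<close>
  have q5: "\<forall>v\<in>?V5. 4 \<le> card (quads_at X v)" and q4: "\<forall>v\<in>?V4. 2 \<le> card (quads_at X v)"
    using quads by (force simp: verts_of_degree_def)+
  have split: "?V4 = (A \<inter> ?V4) \<union> (B \<inter> ?V4)" "?V5 = (A \<inter> ?V5) \<union> (B \<inter> ?V5)"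
    using V by (auto simp: verts_of_degree_def)
  have c: "card ?V4 = card (A \<inter> ?V4) + card (B \<inter> ?V4)" "card ?V5 = card (A \<inter> ?V5) + card (B \<inter> ?V5)"
    by (subst split, rule card_Un_disjoint, use fin disj in auto)+
  \<comment> \<open>Stated for both orders of the partite sets, since either may contain the
    vertices of degree 4.\<close>
  have 544: "class_5_4_4 X"
    if "bipartition X C C'" "card (C \<inter> ?V4) = 2" "C \<inter> ?V5 = {}" "C' \<inter> ?V4 = {}" "card (C' \<inter> ?V5) = 1"
      "C \<union> C' = ?V" "card ?V4 = 2" "card ?V5 = 1" for C C'
  proof -
    have "?V4 \<subseteq> C" "?V5 \<subseteq> C'" using that by (auto simp: verts_of_degree_def)
    then show ?thesis unfolding class_5_4_4_def using that deg q4 q5 by blast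
  qed
  consider (44) "card (A \<inter> ?V4) = 2" "A \<inter> ?V5 = {}" "card (B \<inter> ?V4) = 2" "B \<inter> ?V5 = {}"
    | (45) "card (A \<inter> ?V4) = 2" "A \<inter> ?V5 = {}" "B \<inter> ?V4 = {}" "card (B \<inter> ?V5) = 1"
    | (54) "A \<inter> ?V4 = {}" "card (A \<inter> ?V5) = 1" "card (B \<inter> ?V4) = 2" "B \<inter> ?V5 = {}"
    | (55) "A \<inter> ?V4 = {}" "card (A \<inter> ?V5) = 1" "B \<inter> ?V4 = {}" "card (B \<inter> ?V5) = 1"
    using a b by blast
  then show ?thesis
  proof cases
    case 44
    then have "card ?V4 = 4" "?V5 = {}" using c split by auto
    then have "class_4_4_4_4 X" unfolding class_4_4_4_4_def using AB 44 deg q4 by blast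
    then show ?thesis by blast
  next
    case 45
    then show ?thesis using 544[OF AB] c V by simp
  next
    case 54
    then show ?thesis using 544[OF BA] c V by (simp add: Un_commute)
  next
    case 55
    then have "card ?V5 = 2" "?V4 = {}" using c split by auto
    then have "class_5_5 X" unfolding class_5_5_def using AB 55 deg q5 by blast
    then show ?thesis by blast
  qed
qed

end

text \<open>No edge has the same face on both sides, so a face has as many edges as arcs.
  Alternation makes this number even, which rules out pentagons.\<close>

lemma clar_structure_imp_clar_map:
  assumes "fullerene F" "clar_structure F H M"
  shows "clar_map F H M"
proof -
  interpret fullerene_map F by unfold_locales (rule assms)
  have H: "H \<subseteq> faces F"
    and disj: "\<And>f g. f \<in> H \<Longrightarrow> g \<in> H \<Longrightarrow> f \<noteq> g \<Longrightarrow> face_verts F f \<inter> face_verts F g = {}"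
    and alt: "\<And>f. f \<in> H \<Longrightarrow> \<exists>N. alternating F N f"
    using assms(2) by (auto simp: clar_structure_def clar_set_def resonant_pattern_def)
  have hex: "card f = 6" if f: "f \<in> H" for f
  proof -
    have fF: "f \<in> faces F" using f H by blast
    have "inj_on (edge_of F) f"
    proof (rule inj_onI)
      fix a b assume ab: "a \<in> f" "b \<in> f" "edge_of F a = edge_of F b"
      have "a \<in> ars" "b \<in> ars" using ab fF face_subset by blast+
      moreover have "L a = L b" using ab fF face_eqI by simp
      ultimately show "a = b" using edge_of_eq_iff[of a b] face_at_opp_neq[of b] ab(3) by auto
    qed
    then have "card (face_edges F f) = card f" by (simp add: face_edges_def card_image)
    moreover have "even (card (face_edges F f))"
      using alt[OF f] unfolding alternating_def by (metis dvd_triv_left)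
    ultimately show ?thesis using card_face[OF fF] by auto
  qed
  show ?thesis
    by unfold_locales (use H disj hex assms(2) in \<open>simp_all add: clar_structure_def\<close>)
qed

theorem theorem5p3:
  fixes F :: "('v, 'a) embedded_graph"
    and H :: "'a set set" and M :: "'v set set" and n :: nat
    and P :: "('a exp_arc set, 'a exp_arc) embedded_graph"
  assumes "fullerene F"
    and "card (verts (skel F)) = n"
    and "n mod 6 = 2"
    and "int (clar_number F) = \<lfloor>real n / 6\<rfloor> - 3"
    and "clar_structure F H M"
    and "P = parent_of_expansion F H M"
  shows "connected_plane_graph P \<and>
    real (card (verts (skel P))) = (real n + 16) / 3 \<and>
    card {f. polygon P 4 f} = 10 \<and>
    (\<forall>f\<in>faces P. polygon P 4 f \<or> polygon P 6 f) \<and>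
    (class_5_5 P \<or> class_5_4_4 P \<or> class_4_4_4_4 P)"
proof -
  interpret C: clar_map F H M
    by (rule clar_structure_imp_clar_map) (rule assms)+
  have P: "P = C.P" using assms(6) by (simp add: parent_of_expansion_def)
  \<comment> \<open>With n = 6k + 2 the floor is \<open>k\<close> and \<open>H\<close> has k - 3
    faces, so all counts become linear in \<open>k\<close>.\<close>
  define k where "k = n div 6"
  have n: "n = 6 * k + 2" using assms(3) div_mult_mod_eq[of n 6] by (simp add: k_def)
  have "\<lfloor>real n / 6\<rfloor> = int k" unfolding k_def by (metis floor_divide_of_nat_eq of_nat_numeral)
  moreover have "card H = clar_number F" using assms(5) by (simp add: clar_structure_def clar_set_def)
  ultimately have cH: "card H + 3 = k" using assms(4) by linarith
  \<comment> \<open>\<open>H\<close> covers 6k - 18 of the 6k + 2 vertices, and the other 20 are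
    matched in pairs.\<close>
  have quads: "card (new_quads F M) = 10"
    using C.card_W C.card_D C.card_new_quads cH n assms(2) by linarith
  \<comment> \<open>Euler's formula with 6k + 2 vertices and 9k + 3 edges.\<close>
  have "card (faces F) = 3 * k + 3"
    using C.euler C.card_ars C.card_ars_verts n assms(2) by linarith
  then have verts: "card (faces C.E - C.S) = 2 * k + 6"
    using C.card_verts_P cH by linarith
  have plane: "connected_plane_graph C.P"
    by (rule C.connected_plane_graph_P) (simp add: verts)
  interpret Q: connected_plane_graph C.P by (rule plane)
  have "even (card f)" if "f \<in> faces C.P" for f
    using C.faces_P_polygons[OF that] by (auto simp: polygon_def)
  then obtain A B where AB: "bipartition C.P A B" using Q.even_faces_imp_bipartition by blast
  have V: "verts (skel C.P) = A \<union> B" "A \<inter> B = {}" using AB by (auto simp: bipartition_def)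
  have cAB: "card A + card B = 2 * k + 6"
    using V verts Q.finite_verts by (metis C.P.verts_P card_Un_disjoint finite_Un)
  have "card Q.ars = 6 * card H + 4 * card (new_quads F M)"
    using C.P.card_K C.card_Union_S by (simp add: C.P.arcs_P)
  then have edges: "card (edges C.P) = 3 * k + 11" using Q.card_ars quads cH by linarith
  have excess: "(\<Sum>v\<in>U. degree C.P v - 3) + 3 * card U = 3 * k + 11"
    if "U \<subseteq> verts (skel C.P)" "(\<Sum>v\<in>U. degree C.P v) = card (edges C.P)" for U
  proof -
    have "(\<Sum>v\<in>U. degree C.P v - 3) + (\<Sum>v\<in>U. 3) = (\<Sum>v\<in>U. degree C.P v)"
      unfolding sum.distrib[symmetric] using that(1) C.degree_P_bounds(1) by (intro sum.cong) auto
    then show ?thesis using that(2) edges by simp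
  qed
  have "(\<Sum>v\<in>A. degree C.P v - 3) + 3 * card A = 3 * k + 11"
    "(\<Sum>v\<in>B. degree C.P v - 3) + 3 * card B = 3 * k + 11"
    using V Q.bipartition_sum_degree[OF AB] by (auto intro: excess)
  \<comment> \<open>Both excesses are congruent to 2 modulo 3, and their sum is 2(3k + 11) - 3(2k +
    6) = 4.\<close>
  then have "(\<Sum>v\<in>A. degree C.P v - 3) = 2" "(\<Sum>v\<in>B. degree C.P v - 3) = 2"
    using cAB by presburger+
  from Q.degree_classes[OF AB this C.degree_P_bounds]
  have "class_5_5 C.P \<or> class_5_4_4 C.P \<or> class_4_4_4_4 C.P" by simp
  moreover have "real (card (verts (skel C.P))) = (real n + 16) / 3"
    using verts n by (simp add: C.P.verts_P)
  ultimately show ?thesis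
    using plane C.faces_P_polygons C.card_quads_P quads by (simp add: P)
qed

end
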